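(* Let $p\ge 1$ be an integer, let $\omega_0=e^1\wedge e^{p+1}+\cdots+e^p\wedge e^{2p}$ be the standard Kähler form on $\mathbb{R}^{2p}$, and let $P^{\mathbb{Q}}(\omega_0)$ be its rational Kähler polynomial. For the Clifford algebra $\mathbb{R}_{p,p}$, the $\mathrm{U}(p)$-structure on $\mathbb{R}^{2p}$ with Kähler form $\omega_0$ can be recovered from a minimal left ideal $\mathbb{R}_{p,p}f$; and for each of the Clifford algebras $\mathbb{R}_{p,p+1}$ and $\mathbb{R}_{p,p+2}$, the $\mathrm{U}(p)$-structure on $\mathbb{R}^{2p}$ with Kähler form $\omega_0$ can be recovered by projection from a minimal left ideal $\mathbb{R}_{p,p+1}f$, respectively $\mathbb{R}_{p,p+2}f$. In all three cases the primitive idempotent $f$ satisfies $$\sigma^*(f)=P^{\mathbb{Q}}(\omega_0)\qquad\text{and}\qquad \sigma^*(\langle 2^p f\rangle_2)=\omega_0 ,$$ where in the cases $\mathbb{R}_{p,p+1}$ and $\mathbb{R}_{p,p+2}$ the element $f$ lies in a subalgebra $A\cong\mathbb{R}_{p,p}$, $\sigma^*$ is restricted to $A$, and $\sigma^*(A)$ is identified with $\bigwedge^\bullet(\mathbb{R}^{2p})^*$.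
   Context: Clifford algebra: $\mathbb{R}_{p,q}$ is the real unital associative algebra generated by $e_1,\dots,e_{p+q}$ with $e_ie_j=-e_je_i$ for $i\ne j$, $e_i^2=1$ for $1\le i\le p$ and $e_i^2=-1$ for $p+1\le i\le p+q$. It has the canonical basis $1$ and $e_{i_1}\cdots e_{i_k}$, $i_1<\cdots<i_k$; $\langle x\rangle_k$ denotes the degree-$k$ component of $x\in\mathbb{R}_{p,q}$, i.e. its part in the span of the canonical basis elements $e_{i_1}\cdots e_{i_k}$. Symbol map: $\sigma^*:\mathbb{R}_{p,q}\to\bigwedge^\bullet(\mathbb{R}^{p+q})^*$ is the vector space isomorphism with $\sigma^*(1)=1$ and $\sigma^*(e_{i_1}\cdots e_{i_k})=e^{i_1}\wedge\cdots\wedge e^{i_k}$ for $i_1<\cdots<i_k$, where $e^1,\dots,e^{p+q}$ is the dual basis of the standard basis. Rational Kähler polynomial: for $\omega_0=\sum_{j=1}^n e^j\wedge e^{n+j}$ on $\mathbb{R}^{2n}$, $P^{\mathbb{Q}}(\omega_0)=\frac{1}{2^n}\sum_{m=0}^{n}\frac{\omega_0^m}{m!}$ (wedge powers, $\omega_0^0=1$). Primitive idempotent: a nonzero $f$ with $f^2=f$ that is not a sum of two nonzero orthogonal idempotents; the minimal left ideals of $\mathbb{R}_{p,q}$ are of the form $\mathbb{R}_{p,q}f$ with $f$ a primitive idempotent. $\mathrm{U}(p)$-structure: a triple $(J_0,\omega_0,g_0)$ on $\mathbb{R}^{2p}$ with $g_0$ the standard inner product and $\omega_0(\cdot,\cdot)=g_0(J_0\cdot,\cdot)$,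 where here $J_0(e_k)=e_{k+p}$, $J_0(e_{k+p})=-e_k$ for $k=1,\dots,p$. Since $g_0$ is given, recovering $\omega_0$ is regarded as recovering the structure. Recovered: a $\mathrm{G}$-structure defined by forms $\phi_1,\dots,\phi_k\in\bigwedge^\bullet(\mathbb{R}^{p+q})^*$ is recoverable from a minimal left ideal $\mathbb{R}_{p,q}f$ ($f$ a primitive idempotent) if $\phi_i=\sigma^*(\psi_i(f))$ for algebraic expressions $\psi_i(f)$ in the graded components of $f$ in the Clifford algebra $\mathbb{R}_{p,q}$. Recovered by projection: a $\mathrm{G}$-structure defined by forms $\phi_1,\dots,\phi_k\in\bigwedge^\bullet(\mathbb{R}^{n})^*$, $n<p+q$, is recovered by projection from $\tilde f\in\mathbb{R}_{p,q}$ if $\tilde f$ lies in a subalgebra $A\subset\mathbb{R}_{p,q}$, generated by $n$ of the basis vectors $e_i$, with $A\cong\mathbb{R}_{r,s}$, $r+s=n$, such that, identifying $\sigma^*(A)$ with $\bigwedge^\bullet(\mathbb{R}^n)^*$ (by relabelling the basis vectors), $\phi_i=\sigma^*|_A(\psi_i(\tilde f))$ for algebraic expressions $\psi_i(\tilde f)\in A$ in the graded components of $\tilde f$. Here, for $\mathbb{R}_{p,p+1}$ and $\mathbb{R}_{p,p+2}$, it is recovered from $\tilde f=f$ with $f$ the primitive idempotent of the minimal left ideal. *)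

theory Defs
  imports Complex_Main "HOL-Algebra.Module" "HOL-Algebra.QuotRing"
begin

section \<open>Clifford and exterior algebras\<close>

text \<open>
  An element of the Clifford algebra of a diagonal quadratic form on \<open>\<real>\<^sup>n\<close> is given by its
  coefficients in the canonical basis: \<open>x I\<close> is the coefficient of \<open>e\<^bsub>i1\<^esub> \<cdots> e\<^bsub>ik\<^esub>\<close>
  for \<open>I = {i1 < \<cdots> < ik} \<subseteq> {1..n}\<close>.
\<close>

type_synonym multivector = "nat set \<Rightarrow> real"

text \<open>The sign that sorts the concatenation of the increasing words of \<open>I\<close> and \<open>J\<close>.\<close>

definition reorder_sign :: "nat set \<Rightarrow> nat set \<Rightarrow> real" where
  "reorder_sign I J = (- 1) ^ card {(i, j). i \<in> I \<and> j \<in> J \<and> j < i}"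

text \<open>\<open>e\<^sub>I e\<^sub>J = basis_coeff Q I J \<cdot> e\<^bsub>sym_diff I J\<^esub>\<close> where \<open>e\<^sub>i e\<^sub>i = Q i\<close>.\<close>

definition basis_coeff :: "(nat \<Rightarrow> real) \<Rightarrow> nat set \<Rightarrow> nat set \<Rightarrow> real" where
  "basis_coeff Q I J = reorder_sign I J * (\<Prod>i\<in>I \<inter> J. Q i)"

definition diag_clifford :: "nat \<Rightarrow> (nat \<Rightarrow> real) \<Rightarrow> (real, multivector) module" where
  "diag_clifford n Q =
    \<lparr>carrier = {x. \<forall>I. x I \<noteq> 0 \<longrightarrow> I \<subseteq> {1..n}},
     monoid.mult = (\<lambda>x y K. \<Sum>I\<in>Pow {1..n}. \<Sum>J\<in>Pow {1..n}.
                      if sym_diff I J = K then basis_coeff Q I J * x I * y J else 0),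
     one = (\<lambda>I. if I = {} then 1 else 0),
     zero = (\<lambda>I. 0),
     add = (\<lambda>x y I. x I + y I),
     smult = (\<lambda>c x I. c * x I)\<rparr>"

definition clifford :: "nat \<Rightarrow> nat \<Rightarrow> (real, multivector) module" where
  "clifford p q = diag_clifford (p + q) (\<lambda>i. if i \<le> p then 1 else - 1)"

text \<open>
  The exterior algebra of \<open>(\<real>\<^sup>n)\<^sup>*\<close> on the dual basis \<open>e\<^sup>1, \<dots>, e\<^sup>n\<close>: the same construction with
  \<open>e\<^sup>i e\<^sup>i = 0\<close>, so that the ring multiplication is the wedge product.
\<close>

definition exterior :: "nat \<Rightarrow> (real, multivector) module" where
  "exterior n = diag_clifford n (\<lambda>i. 0)"

text \<open>\<open>e\<^sub>i\<close> in \<^const>\<open>clifford\<close>, and \<open>e\<^sup>i\<close> in \<^const>\<open>exterior\<close>.\<close>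

definition gen :: "nat \<Rightarrow> multivector" where
  "gen i = (\<lambda>I. if I = {i} then 1 else 0)"

definition gen_prod :: "(real, multivector) module \<Rightarrow> nat list \<Rightarrow> multivector" where
  "gen_prod M is = foldr (\<lambda>i x. gen i \<otimes>\<^bsub>M\<^esub> x) is \<one>\<^bsub>M\<^esub>"

definition grade :: "nat \<Rightarrow> multivector \<Rightarrow> multivector" where
  "grade k x = (\<lambda>I. if card I = k then x I else 0)"

text \<open>\<open>\<sigma>\<^sup>*\<close>, extended linearly from \<open>e\<^bsub>i1\<^esub> \<cdots> e\<^bsub>ik\<^esub> \<mapsto> e\<^bsup>i1\<^esup> \<and> \<cdots> \<and> e\<^bsup>ik\<^esup>\<close>, \<open>i1 < \<cdots> < ik\<close>.\<close>

definition symbol :: "nat \<Rightarrow> nat \<Rightarrow> multivector \<Rightarrow> multivector" where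
  "symbol p q x = (\<Oplus>\<^bsub>exterior (p + q)\<^esub> I\<in>Pow {1..p + q}.
     x I \<odot>\<^bsub>exterior (p + q)\<^esub> gen_prod (exterior (p + q)) (sorted_list_of_set I))"


section \<open>Idempotents and left ideals\<close>

definition idempotent :: "('a, 'm) ring_scheme \<Rightarrow> 'a \<Rightarrow> bool" where
  "idempotent R f \<longleftrightarrow> f \<in> carrier R \<and> f \<otimes>\<^bsub>R\<^esub> f = f"

definition primitive_idempotent :: "('a, 'm) ring_scheme \<Rightarrow> 'a \<Rightarrow> bool" where
  "primitive_idempotent R f \<longleftrightarrow> idempotent R f \<and> f \<noteq> \<zero>\<^bsub>R\<^esub> \<and>
     \<not> (\<exists>g h. idempotent R g \<and> idempotent R h \<and> g \<noteq> \<zero>\<^bsub>R\<^esub> \<and> h \<noteq> \<zero>\<^bsub>R\<^esub> \<and>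
          g \<otimes>\<^bsub>R\<^esub> h = \<zero>\<^bsub>R\<^esub> \<and> h \<otimes>\<^bsub>R\<^esub> g = \<zero>\<^bsub>R\<^esub> \<and> f = g \<oplus>\<^bsub>R\<^esub> h)"

definition left_ideal :: "('a, 'm) ring_scheme \<Rightarrow> 'a set \<Rightarrow> bool" where
  "left_ideal R L \<longleftrightarrow> additive_subgroup L R \<and> (\<forall>x\<in>carrier R. \<forall>y\<in>L. x \<otimes>\<^bsub>R\<^esub> y \<in> L)"

definition minimal_left_ideal :: "('a, 'm) ring_scheme \<Rightarrow> 'a set \<Rightarrow> bool" where
  "minimal_left_ideal R L \<longleftrightarrow> left_ideal R L \<and> L \<noteq> {\<zero>\<^bsub>R\<^esub>} \<and>
     (\<forall>K. left_ideal R K \<longrightarrow> K \<subseteq> L \<longrightarrow> K = {\<zero>\<^bsub>R\<^esub>} \<or> K = L)"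

definition left_multiples :: "('a, 'm) ring_scheme \<Rightarrow> 'a \<Rightarrow> 'a set" where
  "left_multiples R f = {x \<otimes>\<^bsub>R\<^esub> f | x. x \<in> carrier R}"


section \<open>Recovering structures from idempotents\<close>

text \<open>Algebraic expressions, with real coefficients, in the graded components of an element.\<close>

datatype alg_expr =
    Component nat
  | Unit
  | Scale real alg_expr
  | Plus alg_expr alg_expr
  | Times alg_expr alg_expr

primrec alg_eval :: "(real, multivector) module \<Rightarrow> multivector \<Rightarrow> alg_expr \<Rightarrow> multivector" where
  "alg_eval M f (Component k) = grade k f"
| "alg_eval M f Unit = \<one>\<^bsub>M\<^esub>"
| "alg_eval M f (Scale c s) = c \<odot>\<^bsub>M\<^esub> alg_eval M f s"
| "alg_eval M f (Plus s t) = alg_eval M f s \<oplus>\<^bsub>M\<^esub> alg_eval M f t"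
| "alg_eval M f (Times s t) = alg_eval M f s \<otimes>\<^bsub>M\<^esub> alg_eval M f t"

text \<open>
  \<open>recovered p q \<Phi> f\<close>: the structure defined by the set \<open>\<Phi>\<close> of forms is recoverable from the
  minimal left ideal \<open>\<real>\<^bsub>p,q\<^esub> f\<close>.
\<close>

definition recovered :: "nat \<Rightarrow> nat \<Rightarrow> multivector set \<Rightarrow> multivector \<Rightarrow> bool" where
  "recovered p q \<Phi> f \<longleftrightarrow>
     primitive_idempotent (clifford p q) f \<and>
     minimal_left_ideal (clifford p q) (left_multiples (clifford p q) f) \<and>
     (\<forall>\<phi>\<in>\<Phi>. \<exists>\<psi>. \<phi> = symbol p q (alg_eval (clifford p q) f \<psi>))"

inductive_set generated_subalgebra :: "(real, multivector) module \<Rightarrow> multivector set \<Rightarrow> multivector set"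
  for M X where
  one: "\<one>\<^bsub>M\<^esub> \<in> generated_subalgebra M X"
| base: "x \<in> X \<Longrightarrow> x \<in> generated_subalgebra M X"
| smult: "x \<in> generated_subalgebra M X \<Longrightarrow> c \<odot>\<^bsub>M\<^esub> x \<in> generated_subalgebra M X"
| add: "x \<in> generated_subalgebra M X \<Longrightarrow> y \<in> generated_subalgebra M X \<Longrightarrow>
          x \<oplus>\<^bsub>M\<^esub> y \<in> generated_subalgebra M X"
| mult: "x \<in> generated_subalgebra M X \<Longrightarrow> y \<in> generated_subalgebra M X \<Longrightarrow>
          x \<otimes>\<^bsub>M\<^esub> y \<in> generated_subalgebra M X"

definition real_algebra_iso ::
  "(real, multivector) module \<Rightarrow> (real, multivector) module \<Rightarrow> (multivector \<Rightarrow> multivector) \<Rightarrow> bool" where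
  "real_algebra_iso M N h \<longleftrightarrow> h \<in> ring_iso M N \<and>
     (\<forall>c. \<forall>x\<in>carrier M. h (c \<odot>\<^bsub>M\<^esub> x) = c \<odot>\<^bsub>N\<^esub> h x)"

text \<open>
  The identification of forms in the \<open>e\<^sup>i\<close>, \<open>i \<in> S\<close>, with forms on \<open>\<real>\<^sup>n\<close> that relabels the basis
  vectors by a bijection \<open>\<pi>\<close> from \<open>S\<close> to \<open>{1..n}\<close>:
  \<open>e\<^bsup>i1\<^esup> \<and> \<cdots> \<and> e\<^bsup>ik\<^esup>\<close> goes to \<open>e\<^bsup>\<pi> i1\<^esup> \<and> \<cdots> \<and> e\<^bsup>\<pi> ik\<^esup>\<close>.
\<close>

definition relabel :: "nat \<Rightarrow> nat set \<Rightarrow> (nat \<Rightarrow> nat) \<Rightarrow> multivector \<Rightarrow> multivector" where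
  "relabel n S \<pi> \<phi> = (\<Oplus>\<^bsub>exterior n\<^esub> I\<in>Pow S.
     \<phi> I \<odot>\<^bsub>exterior n\<^esub> gen_prod (exterior n) (map \<pi> (sorted_list_of_set I)))"

text \<open>
  Recovery by projection from \<open>f \<in> \<real>\<^bsub>p,q\<^esub>\<close>, where \<open>A \<cong> \<real>\<^bsub>r,s\<^esub>\<close> is generated by the \<open>e\<^sub>i\<close>,
  \<open>i \<in> S\<close>. The isomorphism is required to be the one induced by the relabelling \<open>\<pi>\<close>.
\<close>

definition recovered_by_projection ::
  "nat \<Rightarrow> nat \<Rightarrow> nat \<Rightarrow> nat \<Rightarrow> nat set \<Rightarrow> (nat \<Rightarrow> nat) \<Rightarrow> multivector set \<Rightarrow> multivector \<Rightarrow> bool" where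
  "recovered_by_projection p q r s S \<pi> \<Phi> f \<longleftrightarrow>
     r + s < p + q \<and> S \<subseteq> {1..p + q} \<and> card S = r + s \<and> bij_betw \<pi> S {1..r + s} \<and>
     (let A = generated_subalgebra (clifford p q) (gen ` S) in
        (\<exists>h. real_algebra_iso (clifford p q\<lparr>carrier := A\<rparr>) (clifford r s) h \<and>
             (\<forall>i\<in>S. h (gen i) = gen (\<pi> i))) \<and>
        f \<in> A \<and>
        (\<forall>\<phi>\<in>\<Phi>. \<exists>\<psi>. alg_eval (clifford p q) f \<psi> \<in> A \<and>
             \<phi> = relabel (r + s) S \<pi> (symbol p q (alg_eval (clifford p q) f \<psi>))))"


section \<open>The standard unitary structure\<close>

text \<open>Vectors of \<open>\<real>\<^sup>n\<close> are functions of which only the values on \<open>{1..n}\<close> matter.\<close>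

definition std_inner :: "nat \<Rightarrow> (nat \<Rightarrow> real) \<Rightarrow> (nat \<Rightarrow> real) \<Rightarrow> real" where
  "std_inner n u v = (\<Sum>i\<in>{1..n}. u i * v i)"

text \<open>\<open>J\<^sub>0 e\<^sub>k = e\<^bsub>k+p\<^esub>\<close> and \<open>J\<^sub>0 e\<^bsub>k+p\<^esub> = - e\<^sub>k\<close> for \<open>k \<in> {1..p}\<close>.\<close>

definition std_complex_structure :: "nat \<Rightarrow> (nat \<Rightarrow> real) \<Rightarrow> (nat \<Rightarrow> real)" where
  "std_complex_structure p u =
     (\<lambda>i. if i \<in> {1..p} then - u (i + p) else if i \<in> {p + 1..2 * p} then u (i - p) else 0)"

definition kahler_form :: "nat \<Rightarrow> multivector" where
  "kahler_form p = (\<Oplus>\<^bsub>exterior (2 * p)\<^esub> j\<in>{1..p}. gen j \<otimes>\<^bsub>exterior (2 * p)\<^esub> gen (p + j))"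

text \<open>The triple \<open>(J\<^sub>0, \<omega>\<^sub>0, g\<^sub>0)\<close> on \<open>\<real>\<^bsup>2p\<^esup>\<close>; see \<open>kahler_form_eq_inner\<close> below for compatibility.\<close>

definition U_structure ::
  "nat \<Rightarrow> ((nat \<Rightarrow> real) \<Rightarrow> (nat \<Rightarrow> real)) \<times> multivector \<times> ((nat \<Rightarrow> real) \<Rightarrow> (nat \<Rightarrow> real) \<Rightarrow> real)" where
  "U_structure p = (std_complex_structure p, kahler_form p, std_inner (2 * p))"

text \<open>The inner product being given, a \<open>U(p)\<close>-structure is defined by its Kaehler form alone.\<close>

definition defining_forms ::
  "((nat \<Rightarrow> real) \<Rightarrow> (nat \<Rightarrow> real)) \<times> multivector \<times> ((nat \<Rightarrow> real) \<Rightarrow> (nat \<Rightarrow> real) \<Rightarrow> real)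
     \<Rightarrow> multivector set" where
  "defining_forms = (\<lambda>(J, \<omega>, g). {\<omega>})"

text \<open>\<open>P\<^sup>\<rat>(\<omega>)\<close> for a 2-form \<open>\<omega>\<close> on \<open>\<real>\<^bsup>2n\<^esup>\<close>.\<close>

definition rational_kahler_poly :: "nat \<Rightarrow> multivector \<Rightarrow> multivector" where
  "rational_kahler_poly n \<omega> = (1 / 2 ^ n) \<odot>\<^bsub>exterior (2 * n)\<^esub>
     (\<Oplus>\<^bsub>exterior (2 * n)\<^esub> m\<in>{0..n}.
        (1 / fact m) \<odot>\<^bsub>exterior (2 * n)\<^esub> (\<omega> [^]\<^bsub>exterior (2 * n)\<^esub> m))"


section \<open>The construction yields the algebras presented by generators and relations\<close>

lemma reorder_sign_prod:
  assumes "finite I" "finite J"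
  shows "reorder_sign I J = (\<Prod>i\<in>I. \<Prod>j\<in>J. if j < i then - 1 else 1)"
proof -
  have "(\<Prod>i\<in>I. \<Prod>j\<in>J. if j < i then - 1 else 1 :: real)
      = (\<Prod>(i, j)\<in>I \<times> J. if j < i then - 1 else 1)"
    by (simp add: prod.cartesian_product)
  also have "\<dots> = (\<Prod>x\<in>I \<times> J. if x \<in> {(i, j). j < i} then - 1 else 1)"
    by (rule prod.cong) auto
  also have "\<dots> = (\<Prod>x\<in>(I \<times> J) \<inter> {(i, j). j < i}. - 1)"
    using assms by (simp add: prod.If_cases)
  also have "\<dots> = (- 1) ^ card ((I \<times> J) \<inter> {(i, j). j < i})"
    by simp
  also have "(I \<times> J) \<inter> {(i, j). j < i} = {(i, j). i \<in> I \<and> j \<in> J \<and> j < i}"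
    by auto
  finally show ?thesis unfolding reorder_sign_def by simp
qed

lemma prod_sym_diff:
  fixes h :: "'a \<Rightarrow> real"
  assumes "finite I" "finite J" "\<And>i. h i * h i = 1"
  shows "prod h (sym_diff I J) = prod h I * prod h J"
proof -
  have I: "prod h I = prod h (I - J) * prod h (I \<inter> J)"
    using assms by (subst prod.union_disjoint[symmetric]) (auto intro: arg_cong[of _ _ "prod h"])
  have J: "prod h J = prod h (J - I) * prod h (I \<inter> J)"
    using assms by (subst prod.union_disjoint[symmetric]) (auto intro: arg_cong[of _ _ "prod h"])
  have S: "prod h (sym_diff I J) = prod h (I - J) * prod h (J - I)"
    using assms by (subst prod.union_disjoint) auto
  have "prod h (I \<inter> J) * prod h (I \<inter> J) = 1"
    by (simp add: assms(3) flip: prod.distrib)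
  then show ?thesis unfolding I J S by (metis mult.assoc mult.commute mult.right_neutral)
qed

lemma reorder_sign_sym_diff_left:
  assumes "finite I" "finite J" "finite K"
  shows "reorder_sign (sym_diff I J) K = reorder_sign I K * reorder_sign J K"
proof -
  have "prod (\<lambda>i. \<Prod>j\<in>K. if j < i then - 1 else 1 :: real) (sym_diff I J) =
      prod (\<lambda>i. \<Prod>j\<in>K. if j < i then - 1 else 1) I * prod (\<lambda>i. \<Prod>j\<in>K. if j < i then - 1 else 1) J"
    using assms(1,2)
  proof (rule prod_sym_diff)
    fix i :: nat
    show "(\<Prod>j\<in>K. if j < i then - 1 else 1 :: real) * (\<Prod>j\<in>K. if j < i then - 1 else 1) = 1"
      unfolding prod.distrib[symmetric] by (rule prod.neutral) auto
  qed
  then show ?thesis using assms by (simp add: reorder_sign_prod)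
qed

lemma reorder_sign_sym_diff_right:
  assumes "finite I" "finite J" "finite K"
  shows "reorder_sign I (sym_diff J K) = reorder_sign I J * reorder_sign I K"
proof -
  have "(\<Prod>j\<in>sym_diff J K. if j < i then - 1 else 1 :: real)
      = (\<Prod>j\<in>J. if j < i then - 1 else 1) * (\<Prod>j\<in>K. if j < i then - 1 else 1)" for i :: nat
    using assms(2,3) by (rule prod_sym_diff) auto
  then show ?thesis using assms by (simp add: reorder_sign_prod prod.distrib)
qed

lemma sum_swap3:
  "(\<Sum>a\<in>A. \<Sum>b\<in>B. \<Sum>c\<in>C. h a b c) = (\<Sum>b\<in>B. \<Sum>c\<in>C. \<Sum>a\<in>A. h a b c)"
  by (rule trans[OF sum.swap]) (intro sum.cong refl sum.swap)

lemma basis_coeff_assoc: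
  assumes "finite I" "finite J" "finite K"
  shows "basis_coeff Q I J * basis_coeff Q (sym_diff I J) K
       = basis_coeff Q J K * basis_coeff Q I (sym_diff J K)"
proof -
  have L: "(\<Prod>i\<in>I \<inter> J. Q i) * (\<Prod>i\<in>sym_diff I J \<inter> K. Q i) = (\<Prod>i\<in>(I \<inter> J) \<union> (sym_diff I J \<inter> K). Q i)"
    using assms by (subst prod.union_disjoint) auto
  have R: "(\<Prod>i\<in>J \<inter> K. Q i) * (\<Prod>i\<in>I \<inter> sym_diff J K. Q i) = (\<Prod>i\<in>(J \<inter> K) \<union> (I \<inter> sym_diff J K). Q i)"
    using assms by (subst prod.union_disjoint) auto
  have "(I \<inter> J) \<union> (sym_diff I J \<inter> K) = (J \<inter> K) \<union> (I \<inter> sym_diff J K)"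
    by auto
  with L R have Q: "(\<Prod>i\<in>I \<inter> J. Q i) * (\<Prod>i\<in>sym_diff I J \<inter> K. Q i)
      = (\<Prod>i\<in>J \<inter> K. Q i) * (\<Prod>i\<in>I \<inter> sym_diff J K. Q i)"
    by simp
  have S: "reorder_sign I J * reorder_sign (sym_diff I J) K
      = reorder_sign J K * reorder_sign I (sym_diff J K)"
    unfolding reorder_sign_sym_diff_left[OF assms] reorder_sign_sym_diff_right[OF assms] by simp
  have "basis_coeff Q I J * basis_coeff Q (sym_diff I J) K
      = (reorder_sign I J * reorder_sign (sym_diff I J) K) *
        ((\<Prod>i\<in>I \<inter> J. Q i) * (\<Prod>i\<in>sym_diff I J \<inter> K. Q i))"
    unfolding basis_coeff_def by (simp only: mult_ac)
  also have "\<dots> = (reorder_sign J K * reorder_sign I (sym_diff J K)) *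
        ((\<Prod>i\<in>J \<inter> K. Q i) * (\<Prod>i\<in>I \<inter> sym_diff J K. Q i))"
    unfolding S Q ..
  also have "\<dots> = basis_coeff Q J K * basis_coeff Q I (sym_diff J K)"
    unfolding basis_coeff_def by (simp only: mult_ac)
  finally show ?thesis .
qed

lemma diag_clifford_simps:
  "carrier (diag_clifford n Q) = {x. \<forall>I. x I \<noteq> 0 \<longrightarrow> I \<subseteq> {1..n}}"
  "(x \<otimes>\<^bsub>diag_clifford n Q\<^esub> y) K = (\<Sum>I\<in>Pow {1..n}. \<Sum>J\<in>Pow {1..n}.
      if sym_diff I J = K then basis_coeff Q I J * x I * y J else 0)"
  "\<one>\<^bsub>diag_clifford n Q\<^esub> K = (if K = {} then 1 else 0)"
  "\<zero>\<^bsub>diag_clifford n Q\<^esub> K = 0"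
  "(x \<oplus>\<^bsub>diag_clifford n Q\<^esub> y) K = x K + y K"
  "(c \<odot>\<^bsub>diag_clifford n Q\<^esub> x) K = c * x K"
  by (simp_all add: diag_clifford_def)

lemma diag_clifford_mult_closed: "x \<otimes>\<^bsub>diag_clifford n Q\<^esub> y \<in> carrier (diag_clifford n Q)"
proof -
  have "(x \<otimes>\<^bsub>diag_clifford n Q\<^esub> y) K = 0" if "\<not> K \<subseteq> {1..n}" for K
    unfolding diag_clifford_simps using that by (intro sum.neutral ballI) auto
  then show ?thesis by (auto simp: diag_clifford_simps(1))
qed

lemma diag_clifford_basis_left:
  assumes "I \<subseteq> {1..n}"
  shows "((\<lambda>L. if L = I then 1 else 0) \<otimes>\<^bsub>diag_clifford n Q\<^esub> y) K =
    (\<Sum>J\<in>Pow {1..n}. if sym_diff I J = K then basis_coeff Q I J * y J else 0)"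
proof -
  have "((\<lambda>L. if L = I then 1 else 0) \<otimes>\<^bsub>diag_clifford n Q\<^esub> y) K =
      (\<Sum>I'\<in>Pow {1..n}. if I' = I then \<Sum>J\<in>Pow {1..n}. if sym_diff I J = K then basis_coeff Q I J * y J else 0 else 0)"
    unfolding diag_clifford_simps
  proof (intro sum.cong refl)
    fix I'
    show "(\<Sum>J\<in>Pow {1..n}. if sym_diff I' J = K
            then basis_coeff Q I' J * (if I' = I then 1 else 0) * y J else 0) =
        (if I' = I then \<Sum>J\<in>Pow {1..n}. if sym_diff I J = K then basis_coeff Q I J * y J else 0 else 0)"
      by (cases "I' = I") (simp_all cong: if_cong)
  qed
  also have "\<dots> = (\<Sum>J\<in>Pow {1..n}. if sym_diff I J = K then basis_coeff Q I J * y J else 0)"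
    using assms by (subst sum.delta) auto
  finally show ?thesis .
qed

lemma diag_clifford_basis_mult:
  assumes "I \<subseteq> {1..n}" "J \<subseteq> {1..n}"
  shows "(\<lambda>L. if L = I then 1 else 0) \<otimes>\<^bsub>diag_clifford n Q\<^esub> (\<lambda>L. if L = J then 1 else 0) =
    (\<lambda>K. if K = sym_diff I J then basis_coeff Q I J else 0)"
proof
  fix K
  have "((\<lambda>L. if L = I then 1 else 0) \<otimes>\<^bsub>diag_clifford n Q\<^esub> (\<lambda>L. if L = J then 1 else 0)) K =
      (\<Sum>J'\<in>Pow {1..n}. if J' = J then if sym_diff I J = K then basis_coeff Q I J else 0 else 0)"
    unfolding diag_clifford_basis_left[OF assms(1)] by (intro sum.cong refl) simp
  also have "\<dots> = (if sym_diff I J = K then basis_coeff Q I J else 0)"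
    using assms by (subst sum.delta) auto
  finally show "((\<lambda>L. if L = I then 1 else 0) \<otimes>\<^bsub>diag_clifford n Q\<^esub> (\<lambda>L. if L = J then 1 else 0)) K =
      (if K = sym_diff I J then basis_coeff Q I J else 0)"
    by (simp only: eq_commute)
qed

lemma basis_coeff_empty [simp]: "basis_coeff Q {} J = 1" "basis_coeff Q I {} = 1"
  by (simp_all add: basis_coeff_def reorder_sign_def)

lemma diag_clifford_sum_mult:
  "(\<Sum>M\<in>Pow {1..n}. g M * (x \<otimes>\<^bsub>diag_clifford n Q\<^esub> y) M) =
   (\<Sum>I\<in>Pow {1..n}. \<Sum>J\<in>Pow {1..n}. g (sym_diff I J) * basis_coeff Q I J * x I * y J)"
proof -
  let ?P = "Pow {1..n}"
  have "(\<Sum>M\<in>?P. g M * (x \<otimes>\<^bsub>diag_clifford n Q\<^esub> y) M) =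
    (\<Sum>M\<in>?P. \<Sum>I\<in>?P. \<Sum>J\<in>?P.
       if M = sym_diff I J then g M * basis_coeff Q I J * x I * y J else 0)"
    unfolding diag_clifford_simps sum_distrib_left by (intro sum.cong refl) simp
  also have "\<dots> = (\<Sum>I\<in>?P. \<Sum>J\<in>?P. \<Sum>M\<in>?P.
       if M = sym_diff I J then g M * basis_coeff Q I J * x I * y J else 0)"
    by (rule sum_swap3)
  also have "\<dots> = (\<Sum>I\<in>?P. \<Sum>J\<in>?P. g (sym_diff I J) * basis_coeff Q I J * x I * y J)"
  proof (intro sum.cong refl)
    fix I J assume "I \<in> ?P" "J \<in> ?P"
    then have "sym_diff I J \<in> ?P" by auto
    then show "(\<Sum>M\<in>?P. if M = sym_diff I J then g M * basis_coeff Q I J * x I * y J else 0)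
        = g (sym_diff I J) * basis_coeff Q I J * x I * y J"
      by (subst sum.delta) simp_all
  qed
  finally show ?thesis .
qed

lemma diag_clifford_mult_assoc:
  "(x \<otimes>\<^bsub>diag_clifford n Q\<^esub> y) \<otimes>\<^bsub>diag_clifford n Q\<^esub> z
     = x \<otimes>\<^bsub>diag_clifford n Q\<^esub> (y \<otimes>\<^bsub>diag_clifford n Q\<^esub> z)"
proof
  fix K
  let ?P = "Pow {1..n}" and ?b = "basis_coeff Q"
  have fin: "\<And>I. I \<in> ?P \<Longrightarrow> finite I"
    by (auto intro: finite_subset)
  have "((x \<otimes>\<^bsub>diag_clifford n Q\<^esub> y) \<otimes>\<^bsub>diag_clifford n Q\<^esub> z) K =
      (\<Sum>M\<in>?P. \<Sum>L\<in>?P. (if sym_diff M L = K then ?b M L * z L else 0)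
         * (x \<otimes>\<^bsub>diag_clifford n Q\<^esub> y) M)"
    unfolding diag_clifford_simps(2)[of n Q _ z] by (intro sum.cong refl) simp
  also have "\<dots> = (\<Sum>L\<in>?P. \<Sum>M\<in>?P. (if sym_diff M L = K then ?b M L * z L else 0)
         * (x \<otimes>\<^bsub>diag_clifford n Q\<^esub> y) M)"
    by (rule sum.swap)
  also have "\<dots> = (\<Sum>L\<in>?P. \<Sum>I\<in>?P. \<Sum>J\<in>?P.
      (if sym_diff (sym_diff I J) L = K then ?b (sym_diff I J) L * z L else 0) * ?b I J * x I * y J)"
    by (intro sum.cong refl diag_clifford_sum_mult)
  also have "\<dots> = (\<Sum>I\<in>?P. \<Sum>J\<in>?P. \<Sum>L\<in>?P.
      (if sym_diff (sym_diff I J) L = K then ?b (sym_diff I J) L * z L else 0) * ?b I J * x I * y J)"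
    by (rule sum_swap3)
  also have "\<dots> = (\<Sum>I\<in>?P. \<Sum>J\<in>?P. \<Sum>L\<in>?P.
      (if sym_diff I (sym_diff J L) = K then ?b I (sym_diff J L) * x I else 0) * ?b J L * y J * z L)"
  proof (intro sum.cong refl)
    fix I J L assume *: "I \<in> ?P" "J \<in> ?P" "L \<in> ?P"
    have sd: "sym_diff (sym_diff I J) L = sym_diff I (sym_diff J L)"
      by auto
    have "?b (sym_diff I J) L * z L * ?b I J * x I * y J
        = ?b I (sym_diff J L) * x I * ?b J L * y J * z L"
    proof -
      have eq: "?b (sym_diff I J) L * ?b I J = ?b I (sym_diff J L) * ?b J L"
        using basis_coeff_assoc[of I J L Q] fin * by (simp add: mult.commute)
      have "?b (sym_diff I J) L * z L * ?b I J * x I * y J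
          = (?b (sym_diff I J) L * ?b I J) * (x I * y J * z L)"
        by (simp only: mult_ac)
      also have "\<dots> = ?b I (sym_diff J L) * x I * ?b J L * y J * z L"
        unfolding eq by (simp only: mult_ac)
      finally show ?thesis .
    qed
    then show "(if sym_diff (sym_diff I J) L = K then ?b (sym_diff I J) L * z L else 0) * ?b I J * x I * y J
      = (if sym_diff I (sym_diff J L) = K then ?b I (sym_diff J L) * x I else 0) * ?b J L * y J * z L"
      unfolding sd by (cases "sym_diff I (sym_diff J L) = K") (simp_all only: refl if_True if_False mult_zero_left)
  qed
  also have "\<dots> = (\<Sum>I\<in>?P. \<Sum>M\<in>?P. (if sym_diff I M = K then ?b I M * x I else 0)
         * (y \<otimes>\<^bsub>diag_clifford n Q\<^esub> z) M)"
    by (intro sum.cong refl diag_clifford_sum_mult[symmetric])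
  also have "\<dots> = (x \<otimes>\<^bsub>diag_clifford n Q\<^esub> (y \<otimes>\<^bsub>diag_clifford n Q\<^esub> z)) K"
    unfolding diag_clifford_simps(2)[of n Q x] by (intro sum.cong refl) simp
  finally show "((x \<otimes>\<^bsub>diag_clifford n Q\<^esub> y) \<otimes>\<^bsub>diag_clifford n Q\<^esub> z) K
     = (x \<otimes>\<^bsub>diag_clifford n Q\<^esub> (y \<otimes>\<^bsub>diag_clifford n Q\<^esub> z)) K" .
qed

lemma diag_clifford_one_mult:
  assumes "x \<in> carrier (diag_clifford n Q)"
  shows "\<one>\<^bsub>diag_clifford n Q\<^esub> \<otimes>\<^bsub>diag_clifford n Q\<^esub> x = x"
    and "x \<otimes>\<^bsub>diag_clifford n Q\<^esub> \<one>\<^bsub>diag_clifford n Q\<^esub> = x"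
proof -
  have x: "x K = 0" if "\<not> K \<subseteq> {1..n}" for K
    using assms that by (auto simp: diag_clifford_simps(1))
  have "(\<one>\<^bsub>diag_clifford n Q\<^esub> \<otimes>\<^bsub>diag_clifford n Q\<^esub> x) K = x K" for K
  proof -
    have "(\<one>\<^bsub>diag_clifford n Q\<^esub> \<otimes>\<^bsub>diag_clifford n Q\<^esub> x) K =
        (\<Sum>I\<in>Pow {1..n}. if I = {} then \<Sum>J\<in>Pow {1..n}. if J = K then x J else 0 else 0)"
      unfolding diag_clifford_simps by (intro sum.cong refl) (simp cong: if_cong)
    also have "\<dots> = x K"
      using x[of K] by (simp add: Pow_def)
    finally show ?thesis .
  qed
  then show "\<one>\<^bsub>diag_clifford n Q\<^esub> \<otimes>\<^bsub>diag_clifford n Q\<^esub> x = x" by auto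
  have "(x \<otimes>\<^bsub>diag_clifford n Q\<^esub> \<one>\<^bsub>diag_clifford n Q\<^esub>) K = x K" for K
  proof -
    have "(x \<otimes>\<^bsub>diag_clifford n Q\<^esub> \<one>\<^bsub>diag_clifford n Q\<^esub>) K =
        (\<Sum>I\<in>Pow {1..n}. \<Sum>J\<in>Pow {1..n}. if J = {} then if I = K then x I else 0 else 0)"
      unfolding diag_clifford_simps by (intro sum.cong refl) auto
    also have "\<dots> = x K"
      using x[of K] by (simp add: Pow_def)
    finally show ?thesis .
  qed
  then show "x \<otimes>\<^bsub>diag_clifford n Q\<^esub> \<one>\<^bsub>diag_clifford n Q\<^esub> = x" by auto
qed

lemma ring_diag_clifford: "ring (diag_clifford n Q)"
proof (rule ringI)
  show "abelian_group (diag_clifford n Q)"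
  proof (rule abelian_groupI)
    fix x assume "x \<in> carrier (diag_clifford n Q)"
    then show "\<exists>y\<in>carrier (diag_clifford n Q).
        y \<oplus>\<^bsub>diag_clifford n Q\<^esub> x = \<zero>\<^bsub>diag_clifford n Q\<^esub>"
      by (intro bexI[of _ "\<lambda>I. - x I"]) (auto simp: diag_clifford_simps)
  next
    fix x y assume *: "x \<in> carrier (diag_clifford n Q)" "y \<in> carrier (diag_clifford n Q)"
    show "x \<oplus>\<^bsub>diag_clifford n Q\<^esub> y \<in> carrier (diag_clifford n Q)"
      unfolding diag_clifford_simps(1)
    proof (intro CollectI allI impI)
      fix I assume "(x \<oplus>\<^bsub>diag_clifford n Q\<^esub> y) I \<noteq> 0"
      then have "x I \<noteq> 0 \<or> y I \<noteq> 0" by (auto simp: diag_clifford_simps)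
      then show "I \<subseteq> {1..n}" using * by (auto simp: diag_clifford_simps(1))
    qed
  qed (auto simp: diag_clifford_simps)
  show "monoid (diag_clifford n Q)"
    by (rule monoidI)
       (simp_all add: diag_clifford_mult_closed diag_clifford_mult_assoc diag_clifford_one_mult,
        simp add: diag_clifford_simps)
next
  fix x y z
  show "(x \<oplus>\<^bsub>diag_clifford n Q\<^esub> y) \<otimes>\<^bsub>diag_clifford n Q\<^esub> z =
      x \<otimes>\<^bsub>diag_clifford n Q\<^esub> z \<oplus>\<^bsub>diag_clifford n Q\<^esub> y \<otimes>\<^bsub>diag_clifford n Q\<^esub> z"
    unfolding fun_eq_iff diag_clifford_simps sum.distrib[symmetric]
    by (intro allI sum.cong refl) (simp add: algebra_simps)
  show "z \<otimes>\<^bsub>diag_clifford n Q\<^esub> (x \<oplus>\<^bsub>diag_clifford n Q\<^esub> y) =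
      z \<otimes>\<^bsub>diag_clifford n Q\<^esub> x \<oplus>\<^bsub>diag_clifford n Q\<^esub> z \<otimes>\<^bsub>diag_clifford n Q\<^esub> y"
    unfolding fun_eq_iff diag_clifford_simps sum.distrib[symmetric]
    by (intro allI sum.cong refl) (simp add: algebra_simps)
qed

lemma diag_clifford_smult:
  "c \<odot>\<^bsub>diag_clifford n Q\<^esub> (x \<otimes>\<^bsub>diag_clifford n Q\<^esub> y)
     = (c \<odot>\<^bsub>diag_clifford n Q\<^esub> x) \<otimes>\<^bsub>diag_clifford n Q\<^esub> y"
  "c \<odot>\<^bsub>diag_clifford n Q\<^esub> (x \<otimes>\<^bsub>diag_clifford n Q\<^esub> y)
     = x \<otimes>\<^bsub>diag_clifford n Q\<^esub> (c \<odot>\<^bsub>diag_clifford n Q\<^esub> y)"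
  unfolding fun_eq_iff diag_clifford_simps sum_distrib_left
  by (intro allI sum.cong refl; simp)+

lemma gen_square:
  assumes "i \<in> {1..n}"
  shows "gen i \<otimes>\<^bsub>diag_clifford n Q\<^esub> gen i = Q i \<odot>\<^bsub>diag_clifford n Q\<^esub> \<one>\<^bsub>diag_clifford n Q\<^esub>"
proof
  fix K
  have "basis_coeff Q {i} {i} = Q i"
    by (simp add: basis_coeff_def reorder_sign_prod)
  then show "(gen i \<otimes>\<^bsub>diag_clifford n Q\<^esub> gen i) K
      = (Q i \<odot>\<^bsub>diag_clifford n Q\<^esub> \<one>\<^bsub>diag_clifford n Q\<^esub>) K"
    using assms unfolding gen_def diag_clifford_simps(3,6)
    by (subst diag_clifford_basis_mult) auto
qed

lemma gen_anticommute:
  assumes "i \<in> {1..n}" "j \<in> {1..n}" "i \<noteq> j"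
  shows "gen i \<otimes>\<^bsub>diag_clifford n Q\<^esub> gen j
       = (- 1) \<odot>\<^bsub>diag_clifford n Q\<^esub> (gen j \<otimes>\<^bsub>diag_clifford n Q\<^esub> gen i)"
proof
  fix K
  have "{i} \<inter> {j} = {}" "{j} \<inter> {i} = {}"
    using assms(3) by auto
  then have "basis_coeff Q {i} {j} = - basis_coeff Q {j} {i}"
    using assms(3) unfolding basis_coeff_def
    by (cases i j rule: linorder_cases) (simp_all add: reorder_sign_prod)
  moreover have "sym_diff {i} {j} = {i, j}" "sym_diff {j} {i} = {i, j}"
    using assms by auto
  ultimately show "(gen i \<otimes>\<^bsub>diag_clifford n Q\<^esub> gen j) K
       = ((- 1) \<odot>\<^bsub>diag_clifford n Q\<^esub> (gen j \<otimes>\<^bsub>diag_clifford n Q\<^esub> gen i)) K"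
    using assms(1,2) unfolding gen_def diag_clifford_simps(6)
    by (subst (1 2) diag_clifford_basis_mult) auto
qed

text \<open>The ordered products of generators are the unit coefficient vectors, hence a basis.\<close>

lemma gen_prod_sorted:
  assumes "set is \<subseteq> {1..n}" "sorted_wrt (<) is"
  shows "gen_prod (diag_clifford n Q) is = (\<lambda>I. if I = set is then 1 else 0)"
  using assms
proof (induction "is")
  case Nil
  then show ?case by (auto simp: gen_prod_def diag_clifford_simps)
next
  case (Cons i "is")
  have "gen_prod (diag_clifford n Q) (i # is)
      = gen i \<otimes>\<^bsub>diag_clifford n Q\<^esub> gen_prod (diag_clifford n Q) is"
    by (simp add: gen_prod_def)
  also have "\<dots> = (\<lambda>K. if K = sym_diff {i} (set is) then basis_coeff Q {i} (set is) else 0)"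
    unfolding gen_def using Cons by (subst diag_clifford_basis_mult[symmetric]) auto
  also have "sym_diff {i} (set is) = set (i # is)"
    using Cons.prems(2) by auto
  also have "basis_coeff Q {i} (set is) = 1"
  proof -
    have "(\<Prod>j\<in>set is. if j < i then - 1 else 1 :: real) = 1"
      using Cons.prems(2) by (intro prod.neutral) auto
    moreover have "{i} \<inter> set is = {}"
      using Cons.prems(2) by auto
    ultimately show ?thesis by (simp add: basis_coeff_def reorder_sign_prod)
  qed
  finally show ?case .
qed

lemma gen_prod_sorted_list_of_set:
  assumes "I \<subseteq> {1..n}"
  shows "gen_prod (diag_clifford n Q) (sorted_list_of_set I) = (\<lambda>J. if J = I then 1 else 0)"
  using assms finite_subset[OF assms] by (simp add: gen_prod_sorted)

lemma finsum_diag_clifford: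
  assumes "finite S" "\<And>s. s \<in> S \<Longrightarrow> h s \<in> carrier (diag_clifford n Q)"
  shows "(\<Oplus>\<^bsub>diag_clifford n Q\<^esub> s\<in>S. h s) = (\<lambda>I. \<Sum>s\<in>S. h s I)"
  using assms
proof (induction rule: finite_induct)
  case empty
  interpret ring "diag_clifford n Q" by (rule ring_diag_clifford)
  show ?case by (auto simp: diag_clifford_simps)
next
  case (insert s S)
  interpret ring "diag_clifford n Q" by (rule ring_diag_clifford)
  show ?case
    using insert by (subst finsum_insert) (auto simp: diag_clifford_simps(5) Pi_def)
qed

lemma diag_clifford_basis_expansion:
  assumes "x \<in> carrier (diag_clifford n Q)"
  shows "x = (\<Oplus>\<^bsub>diag_clifford n Q\<^esub> I\<in>Pow {1..n}.
     x I \<odot>\<^bsub>diag_clifford n Q\<^esub> gen_prod (diag_clifford n Q) (sorted_list_of_set I))"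
proof -
  have *: "(x I \<odot>\<^bsub>diag_clifford n Q\<^esub> gen_prod (diag_clifford n Q) (sorted_list_of_set I))
      = (\<lambda>J. if J = I then x I else 0)" if "I \<in> Pow {1..n}" for I
    using that by (auto simp: diag_clifford_simps gen_prod_sorted_list_of_set)
  have "(\<Oplus>\<^bsub>diag_clifford n Q\<^esub> I\<in>Pow {1..n}.
     x I \<odot>\<^bsub>diag_clifford n Q\<^esub> gen_prod (diag_clifford n Q) (sorted_list_of_set I))
     = (\<lambda>J. \<Sum>I\<in>Pow {1..n}. (x I \<odot>\<^bsub>diag_clifford n Q\<^esub>
           gen_prod (diag_clifford n Q) (sorted_list_of_set I)) J)"
    by (rule finsum_diag_clifford)
       (auto simp: * simp: diag_clifford_simps(1) split: if_splits)
  also have "\<dots> = (\<lambda>J. \<Sum>I\<in>Pow {1..n}. if J = I then x I else 0)"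
    using * by (intro ext sum.cong) auto
  also have "\<dots> = x"
    using assms by (intro ext) (auto simp: diag_clifford_simps(1))
  finally show ?thesis by simp
qed


section \<open>Compatibility of the unitary structure\<close>

text \<open>The value of the degree-2 part of a form on a pair of vectors.\<close>

definition eval_two_form :: "nat \<Rightarrow> multivector \<Rightarrow> (nat \<Rightarrow> real) \<Rightarrow> (nat \<Rightarrow> real) \<Rightarrow> real" where
  "eval_two_form n \<omega> u v =
     (\<Sum>(i, j) | i \<in> {1..n} \<and> j \<in> {1..n} \<and> i < j. \<omega> {i, j} * (u i * v j - u j * v i))"

lemma kahler_form_coeff:
  "kahler_form p = (\<lambda>I. if \<exists>j\<in>{1..p}. I = {j, p + j} then 1 else 0)"
proof -
  have *: "gen j \<otimes>\<^bsub>exterior (2 * p)\<^esub> gen (p + j) = (\<lambda>I. if I = {j, p + j} then 1 else 0)"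
    if "j \<in> {1..p}" for j
  proof -
    have "gen j \<otimes>\<^bsub>exterior (2 * p)\<^esub> gen (p + j)
        = (\<lambda>I. if I = sym_diff {j} {p + j} then basis_coeff (\<lambda>_. 0) {j} {p + j} else 0)"
      unfolding exterior_def gen_def using that by (subst diag_clifford_basis_mult) auto
    moreover have "sym_diff {j} {p + j} = {j, p + j}" using that by auto
    moreover have "basis_coeff (\<lambda>_. 0) {j} {p + j} = 1"
      using that by (simp add: basis_coeff_def reorder_sign_prod)
    ultimately show ?thesis by (simp cong: if_cong)
  qed
  have "kahler_form p = (\<lambda>I. \<Sum>j\<in>{1..p}. (gen j \<otimes>\<^bsub>exterior (2 * p)\<^esub> gen (p + j)) I)"
    unfolding kahler_form_def exterior_def
    by (rule finsum_diag_clifford) (simp_all add: diag_clifford_mult_closed)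
  also have "\<dots> = (\<lambda>I. \<Sum>j\<in>{1..p}. if I = {j, p + j} then 1 else 0)"
    using * by (intro ext sum.cong) auto
  also have "\<dots> = (\<lambda>I. if \<exists>j\<in>{1..p}. I = {j, p + j} then 1 else 0)"
  proof
    fix I
    show "(\<Sum>j\<in>{1..p}. if I = {j, p + j} then 1 else 0 :: real)
        = (if \<exists>j\<in>{1..p}. I = {j, p + j} then 1 else 0)"
    proof (cases "\<exists>j\<in>{1..p}. I = {j, p + j}")
      case True
      then obtain k where k: "k \<in> {1..p}" "I = {k, p + k}" by blast
      have "(I = {j, p + j}) = (j = k)" if "j \<in> {1..p}" for j
        using that k by (auto simp: doubleton_eq_iff)
      then have "(\<Sum>j\<in>{1..p}. if I = {j, p + j} then 1 else 0 :: real)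
          = (\<Sum>j\<in>{1..p}. if j = k then 1 else 0)"
        by (intro sum.cong) auto
      then show ?thesis using k True by (simp add: sum.delta)
    qed (auto intro!: sum.neutral)
  qed
  finally show ?thesis .
qed

lemma kahler_form_eq_inner:
  "eval_two_form (2 * p) (kahler_form p) u v = std_inner (2 * p) (std_complex_structure p u) v"
proof -
  let ?P = "{(i, j). i \<in> {1..2 * p} \<and> j \<in> {1..2 * p} \<and> i < j}"
  let ?D = "(\<lambda>i. (i, p + i)) ` {1..p}"
  have fin: "finite ?P"
    by (rule finite_subset[of _ "{1..2 * p} \<times> {1..2 * p}"]) auto
  have "eval_two_form (2 * p) (kahler_form p) u v
      = (\<Sum>(i, j)\<in>?D. kahler_form p {i, j} * (u i * v j - u j * v i))"
    unfolding eval_two_form_def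
  proof (rule sum.mono_neutral_right[OF fin])
    show "?D \<subseteq> ?P" by auto
    show "\<forall>x\<in>?P - ?D. (case x of (i, j) \<Rightarrow> kahler_form p {i, j} * (u i * v j - u j * v i)) = 0"
      by (auto simp: kahler_form_coeff doubleton_eq_iff image_iff)
  qed
  also have "\<dots> = (\<Sum>i\<in>{1..p}. u i * v (p + i) - u (p + i) * v i)"
  proof -
    have "kahler_form p {i, p + i} = 1" if "i \<in> {1..p}" for i
      using that unfolding kahler_form_coeff by auto
    then show ?thesis
      by (subst sum.reindex) (auto simp: inj_on_def intro!: sum.cong)
  qed
  finally have L: "eval_two_form (2 * p) (kahler_form p) u v
      = (\<Sum>i\<in>{1..p}. u i * v (p + i)) - (\<Sum>i\<in>{1..p}. u (p + i) * v i)"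
    by (simp add: sum_subtractf)
  have "(\<lambda>i. p + i) ` {1..p} = {p + 1..p + p}"
    by (simp add: image_add_atLeastAtMost)
  then have "{1..2 * p} = {1..p} \<union> (\<lambda>i. p + i) ` {1..p}"
    by auto
  then have "std_inner (2 * p) (std_complex_structure p u) v
      = (\<Sum>i\<in>{1..p} \<union> (\<lambda>i. p + i) ` {1..p}. std_complex_structure p u i * v i)"
    unfolding std_inner_def by simp
  also have "\<dots> = (\<Sum>i\<in>{1..p}. std_complex_structure p u i * v i)
      + (\<Sum>i\<in>{1..p}. std_complex_structure p u (p + i) * v (p + i))"
    by (subst sum.union_disjoint) (auto simp: sum.reindex simp del: image_add_atLeastAtMost)
  also have "\<dots> = - (\<Sum>i\<in>{1..p}. u (p + i) * v i) + (\<Sum>i\<in>{1..p}. u i * v (p + i))"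
    by (simp add: std_complex_structure_def add.commute flip: sum_negf)
  finally show ?thesis using L by simp
qed

end

theory Submission
  imports Defs
begin

text \<open>
  The idempotent is \<open>f = \<Prod>\<^sub>j (1 + u\<^sub>j) / 2\<close> with the commuting involutions \<open>u\<^sub>j = e\<^sub>j e\<^bsub>p+j\<^esub>\<close>. The pairs
  \<open>{j, p + j}\<close> being disjoint, the product of the \<open>u\<^sub>j\<close> over a set of indices has the same canonical
  coefficients in the Clifford as in the exterior algebra, where it is the corresponding term of
  \<open>\<omega>\<^sub>0\<^sup>m / m!\<close>; hence the symbol of \<open>f\<close> is the rational Kaehler polynomial.

  For minimality of the left ideal of \<open>f\<close>, let \<open>x = x f \<noteq> 0\<close>. Some \<open>z = f e\<^sub>K x\<close> has a nonzero
  coefficient at \<open>1\<close>. An element fixed by all \<open>u\<^sub>j\<close> on both sides is determined by its coefficients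
  at the products of the \<open>e\<^sub>i\<close> with \<open>i > 2 p\<close>. These span \<open>\<real>\<close>, \<open>\<complex>\<close> or the quaternions, so the
  conjugate of that part of \<open>z\<close> multiplies \<open>z\<close> to a positive multiple of \<open>f\<close>.
\<close>

section \<open>Minimal left ideals and primitive idempotents\<close>

lemma (in ring) left_ideal_left_multiples:
  assumes "f \<in> carrier R"
  shows "left_ideal R (left_multiples R f)"
  unfolding left_ideal_def
proof (intro conjI ballI)
  show "additive_subgroup (left_multiples R f) R"
  proof (rule additive_subgroupI, rule add.subgroupI)
    show "left_multiples R f \<subseteq> carrier R" "left_multiples R f \<noteq> {}"
      using assms unfolding left_multiples_def by auto
  next
    fix a assume "a \<in> left_multiples R f"
    then obtain x where "x \<in> carrier R" "a = x \<otimes> f" unfolding left_multiples_def by auto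
    then show "\<ominus> a \<in> left_multiples R f"
      using assms unfolding left_multiples_def by (auto simp flip: l_minus)
  next
    fix a b assume "a \<in> left_multiples R f" "b \<in> left_multiples R f"
    then obtain x y where "x \<in> carrier R" "a = x \<otimes> f" "y \<in> carrier R" "b = y \<otimes> f"
      unfolding left_multiples_def by auto
    then show "a \<oplus> b \<in> left_multiples R f"
      using assms unfolding left_multiples_def by (auto simp flip: l_distr)
  qed
next
  fix a b assume "a \<in> carrier R" "b \<in> left_multiples R f"
  then show "a \<otimes> b \<in> left_multiples R f"
    using assms unfolding left_multiples_def by (auto simp flip: m_assoc)
qed

text \<open>A nonzero \<open>x\<close> in a left ideal \<open>K\<close> below \<open>R f\<close> has
  the form \<open>y f\<close>, hence satisfies \<open>x f = x\<close>. By \<open>gen\<close> its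
  multiples then reach \<open>f\<close>, and \<open>K\<close> is everything.\<close>

lemma (in ring) minimal_left_ideal_left_multiples:
  assumes "idempotent R f" "f \<noteq> \<zero>"
    and gen: "\<And>x. x \<in> carrier R \<Longrightarrow> x \<otimes> f = x \<Longrightarrow> x \<noteq> \<zero> \<Longrightarrow> \<exists>a\<in>carrier R. a \<otimes> x = f"
  shows "minimal_left_ideal R (left_multiples R f)"
  unfolding minimal_left_ideal_def
proof (intro conjI allI impI)
  have f: "f \<in> carrier R" "f \<otimes> f = f" using assms(1) by (auto simp: idempotent_def)
  show "left_ideal R (left_multiples R f)" by (rule left_ideal_left_multiples[OF f(1)])
  show "left_multiples R f \<noteq> {\<zero>}"
  proof
    assume "left_multiples R f = {\<zero>}"
    moreover have "f \<in> left_multiples R f"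
      unfolding left_multiples_def using f by (metis (mono_tags, lifting) mem_Collect_eq)
    ultimately show False using assms(2) by auto
  qed
  fix K assume K: "left_ideal R K" "K \<subseteq> left_multiples R f"
  have zero: "\<zero> \<in> K"
    using K(1) additive_subgroup.zero_closed by (auto simp: left_ideal_def)
  show "K = {\<zero>} \<or> K = left_multiples R f"
  proof (cases "K \<subseteq> {\<zero>}")
    case False
    then obtain x where x: "x \<in> K" "x \<noteq> \<zero>" by auto
    then obtain y where y: "y \<in> carrier R" "x = y \<otimes> f"
      using K(2) unfolding left_multiples_def by auto
    then obtain a where "a \<in> carrier R" "a \<otimes> x = f"
      using gen[of x] x f by (auto simp: m_assoc)
    then have "f \<in> K" using K(1) x(1) unfolding left_ideal_def by auto
    then have "left_multiples R f \<subseteq> K"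
      using K(1) unfolding left_ideal_def left_multiples_def by auto
    then show ?thesis using K(2) by auto
  qed (use zero in auto)
qed

text \<open>In a splitting \<open>f = g + h\<close>, orthogonality gives \<open>g = g f\<close>, so
  \<open>R g\<close> lies in \<open>R f\<close> and equals it by minimality. Writing
  \<open>f = y g\<close> yields \<open>h = f h = y g h = 0\<close>.\<close>

lemma (in ring) primitive_idempotent_if_minimal_left_ideal:
  assumes "idempotent R f" "f \<noteq> \<zero>" "minimal_left_ideal R (left_multiples R f)"
  shows "primitive_idempotent R f"
  unfolding primitive_idempotent_def
proof (intro conjI notI)
  show "idempotent R f" "f = \<zero> \<Longrightarrow> False" using assms by auto
  assume "\<exists>g h. idempotent R g \<and> idempotent R h \<and> g \<noteq> \<zero> \<and> h \<noteq> \<zero> \<and>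
          g \<otimes> h = \<zero> \<and> h \<otimes> g = \<zero> \<and> f = g \<oplus> h"
  then obtain g h where g: "g \<in> carrier R" "g \<otimes> g = g" "g \<noteq> \<zero>"
    and h: "h \<in> carrier R" "h \<otimes> h = h" "h \<noteq> \<zero>"
    and gh: "g \<otimes> h = \<zero>" "h \<otimes> g = \<zero>" "f = g \<oplus> h"
    by (auto simp: idempotent_def)
  have f: "f \<in> carrier R" "f \<otimes> f = f" using assms(1) by (auto simp: idempotent_def)
  have gf: "g \<otimes> f = g" "f \<otimes> h = h"
    using g h gh by (simp_all add: r_distr l_distr)
  have "left_multiples R g \<subseteq> left_multiples R f"
  proof
    fix z assume "z \<in> left_multiples R g"
    then obtain x where "x \<in> carrier R" "z = (x \<otimes> g) \<otimes> f"
      using g(1) f(1) gf(1) unfolding left_multiples_def by (auto simp: m_assoc)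
    then show "z \<in> left_multiples R f" using g(1) unfolding left_multiples_def by blast
  qed
  moreover have "g \<in> left_multiples R g"
    unfolding left_multiples_def using g by (metis (mono_tags, lifting) mem_Collect_eq)
  ultimately have "left_multiples R g = left_multiples R f"
    using assms(3) g(3) left_ideal_left_multiples[OF g(1)]
    unfolding minimal_left_ideal_def by auto
  moreover have "f \<in> left_multiples R f"
    unfolding left_multiples_def using f by (metis (mono_tags, lifting) mem_Collect_eq)
  ultimately obtain y where "y \<in> carrier R" "f = y \<otimes> g"
    unfolding left_multiples_def by auto
  then have "f \<otimes> h = \<zero>" using g(1) h(1) gh(1) by (simp add: m_assoc)
  with gf(2) h(3) show False by simp
qed


section \<open>Multiplication by basis elements\<close>

definition blade :: "nat set \<Rightarrow> multivector" where
  "blade I = (\<lambda>L. if L = I then 1 else 0)"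

lemma blade_closed: "I \<subseteq> {1..n} \<Longrightarrow> blade I \<in> carrier (diag_clifford n Q)"
  by (auto simp: blade_def diag_clifford_simps(1) split: if_splits)

lemma carrier_outside: "x \<in> carrier (diag_clifford n Q) \<Longrightarrow> \<not> I \<subseteq> {1..n} \<Longrightarrow> x I = 0"
  by (auto simp: diag_clifford_simps(1))

text \<open>For fixed \<open>I\<close> the equation \<open>sym_diff I J = K\<close> has the single
  solution \<open>J = sym_diff I K\<close>. If that set leaves \<open>{1..n}\<close>, the
  coefficient of \<open>y\<close> there is zero, so no side condition remains.\<close>

lemma diag_clifford_mult_eq:
  assumes "x \<in> carrier (diag_clifford n Q)" "y \<in> carrier (diag_clifford n Q)"
  shows "(x \<otimes>\<^bsub>diag_clifford n Q\<^esub> y) K =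
    (\<Sum>I\<in>Pow {1..n}. basis_coeff Q I (sym_diff I K) * x I * y (sym_diff I K))"
  unfolding diag_clifford_simps(2)
proof (intro sum.cong refl)
  fix I assume "I \<in> Pow {1..n}"
  have "(\<Sum>J\<in>Pow {1..n}. if sym_diff I J = K then basis_coeff Q I J * x I * y J else 0)
      = (\<Sum>J\<in>Pow {1..n}. if sym_diff I K = J then basis_coeff Q I J * x I * y J else 0)"
    by (intro sum.cong refl) (rule if_cong; auto)
  also have "\<dots> = basis_coeff Q I (sym_diff I K) * x I * y (sym_diff I K)"
    using carrier_outside[OF assms(2), of "sym_diff I K"] by (subst sum.delta') auto
  finally show "(\<Sum>J\<in>Pow {1..n}. if sym_diff I J = K then basis_coeff Q I J * x I * y J else 0) =
      basis_coeff Q I (sym_diff I K) * x I * y (sym_diff I K)" .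
qed

lemma blade_mult_left:
  assumes "I \<subseteq> {1..n}" "y \<in> carrier (diag_clifford n Q)"
  shows "(blade I \<otimes>\<^bsub>diag_clifford n Q\<^esub> y) K = basis_coeff Q I (sym_diff I K) * y (sym_diff I K)"
proof -
  have "(blade I \<otimes>\<^bsub>diag_clifford n Q\<^esub> y) K =
    (\<Sum>I'\<in>Pow {1..n}. if I' = I then basis_coeff Q I' (sym_diff I' K) * y (sym_diff I' K) else 0)"
    by (subst diag_clifford_mult_eq[OF blade_closed[OF assms(1)] assms(2)])
       (intro sum.cong refl, simp add: blade_def)
  then show ?thesis using assms(1) by (simp add: sum.delta)
qed

lemma diag_clifford_mult_expand:
  assumes "x \<in> carrier (diag_clifford n Q)" "y \<in> carrier (diag_clifford n Q)"
  shows "(x \<otimes>\<^bsub>diag_clifford n Q\<^esub> y) K =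
    (\<Sum>I\<in>Pow {1..n}. x I * (blade I \<otimes>\<^bsub>diag_clifford n Q\<^esub> y) K)"
  unfolding diag_clifford_mult_eq[OF assms]
  by (intro sum.cong refl) (use assms(2) in \<open>simp add: blade_mult_left\<close>)

lemma blade_mult_right:
  assumes "I \<subseteq> {1..n}" "y \<in> carrier (diag_clifford n Q)"
  shows "(y \<otimes>\<^bsub>diag_clifford n Q\<^esub> blade I) K = basis_coeff Q (sym_diff I K) I * y (sym_diff I K)"
proof -
  have "(y \<otimes>\<^bsub>diag_clifford n Q\<^esub> blade I) K =
    (\<Sum>L\<in>Pow {1..n}. if L = sym_diff I K then basis_coeff Q L I * y L else 0)"
  proof (subst diag_clifford_mult_eq[OF assms(2) blade_closed[OF assms(1)]], intro sum.cong refl)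
    fix L
    have "sym_diff L K = I \<longleftrightarrow> L = sym_diff I K" by auto
    then show "basis_coeff Q L (sym_diff L K) * y L * blade I (sym_diff L K)
        = (if L = sym_diff I K then basis_coeff Q L I * y L else 0)"
      by (auto simp: blade_def)
  qed
  also have "\<dots> = basis_coeff Q (sym_diff I K) I * y (sym_diff I K)"
    using carrier_outside[OF assms(2), of "sym_diff I K"] by (subst sum.delta) auto
  finally show ?thesis .
qed

lemma blade_mult:
  assumes "I \<subseteq> {1..n}" "J \<subseteq> {1..n}"
  shows "blade I \<otimes>\<^bsub>diag_clifford n Q\<^esub> blade J
    = basis_coeff Q I J \<odot>\<^bsub>diag_clifford n Q\<^esub> blade (sym_diff I J)"
  unfolding blade_def diag_clifford_basis_mult[OF assms] by (auto simp: diag_clifford_simps(6))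

section \<open>Commutation with basis elements of even degree\<close>

text \<open>The two signs together count the pairs of distinct indices. Each \<open>i\<close> in
  \<open>I\<close> contributes \<open>card (J - {i})\<close> of them, which is odd exactly when
  \<open>i\<close> lies in \<open>J\<close>.\<close>

lemma reorder_sign_even_commute:
  assumes "finite I" "finite J" "even (card J)"
  shows "reorder_sign I J = (- 1) ^ card (I \<inter> J) * reorder_sign J I"
proof -
  have "reorder_sign J I = (\<Prod>i\<in>I. \<Prod>j\<in>J. if i < j then - 1 else 1)"
    using assms(1,2) by (simp add: reorder_sign_prod prod.swap[of _ J])
  then have "reorder_sign I J * reorder_sign J I = (\<Prod>i\<in>I. \<Prod>j\<in>J. if i = j then 1 else - 1)"
    using assms(1,2) unfolding reorder_sign_prod[OF assms(1,2)]
    by (simp flip: prod.distrib) (intro prod.cong refl, auto)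
  also have "\<dots> = (\<Prod>i\<in>I. if i \<in> J then - 1 else 1)"
  proof (intro prod.cong refl)
    fix i
    have "(\<Prod>j\<in>J. if i = j then 1 else - 1 :: real) = (\<Prod>j\<in>J - {i}. - 1)"
      using assms(2) by (intro prod.mono_neutral_cong_right) auto
    also have "\<dots> = (- 1) ^ card (J - {i})" by simp
    also have "\<dots> = (if i \<in> J then - 1 else 1)"
    proof (cases "i \<in> J")
      case True
      then have "Suc (card (J - {i})) = card J" using assms(2) by (metis card.remove)
      then have "odd (card (J - {i}))" using assms(3) by (metis even_Suc)
      then show ?thesis using True by simp
    qed (use assms(3) in simp)
    finally show "(\<Prod>j\<in>J. if i = j then 1 else - 1 :: real) = (if i \<in> J then - 1 else 1)" .
  qed
  also have "\<dots> = (- 1) ^ card (I \<inter> J)"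
    using assms(1) by (simp add: prod.If_cases)
  finally have *: "reorder_sign I J * reorder_sign J I = (- 1) ^ card (I \<inter> J)" .
  have "reorder_sign J I * reorder_sign J I = 1"
    unfolding reorder_sign_def by (simp flip: power_add add: mult_2[symmetric])
  then show ?thesis using * by (metis mult.assoc mult.right_neutral)
qed

lemma basis_coeff_even_commute:
  assumes "finite I" "finite J" "even (card J)"
  shows "basis_coeff Q I J = (- 1) ^ card (I \<inter> J) * basis_coeff Q J I"
  unfolding basis_coeff_def reorder_sign_even_commute[OF assms] by (simp add: Int_commute)

text \<open>The sign from \<open>basis_coeff_even_commute\<close> is governed by
  \<open>J - K\<close>, which has the parity of \<open>J \<inter> K\<close> because
  \<open>card J\<close> is even. Left and right multiplication by \<open>u_j\<close> can thus be
  compared coefficient by coefficient.\<close>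

lemma mult_even_blade:
  assumes "J \<subseteq> {1..n}" "even (card J)" "x \<in> carrier (diag_clifford n Q)"
  shows "(x \<otimes>\<^bsub>diag_clifford n Q\<^esub> blade J) K
    = (- 1) ^ card (J \<inter> K) * (blade J \<otimes>\<^bsub>diag_clifford n Q\<^esub> x) K"
proof (cases "sym_diff J K \<subseteq> {1..n}")
  case True
  have fin: "finite (sym_diff J K)" "finite J"
    using finite_subset[OF True] finite_subset[OF assms(1)] by simp_all
  have "card J = card (sym_diff J K \<inter> J) + card (J \<inter> K)"
    using fin by (subst card_Un_disjoint[symmetric]) (auto intro: arg_cong[of _ _ card])
  then have "even (card (sym_diff J K \<inter> J)) = even (card (J \<inter> K))"
    using assms(2) by (metis even_add)
  then have "(- 1 :: real) ^ card (sym_diff J K \<inter> J) = (- 1) ^ card (J \<inter> K)"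
    by (simp add: minus_one_power_iff)
  then show ?thesis
    using basis_coeff_even_commute[OF fin assms(2), of Q] assms
    by (simp add: blade_mult_left blade_mult_right)
next
  case False
  then show ?thesis using assms carrier_outside[OF assms(3) False]
    by (simp add: blade_mult_left blade_mult_right)
qed

text \<open>Only equal index sets multiply into the coefficient of 1, and equal index sets give a
  symmetric expression. This is the trace property.\<close>

lemma mult_coeff_empty_commute:
  assumes "x \<in> carrier (diag_clifford n Q)" "y \<in> carrier (diag_clifford n Q)"
  shows "(x \<otimes>\<^bsub>diag_clifford n Q\<^esub> y) {} = (y \<otimes>\<^bsub>diag_clifford n Q\<^esub> x) {}"
  unfolding diag_clifford_mult_eq[OF assms] diag_clifford_mult_eq[OF assms(2,1)]
  by (intro sum.cong refl) simp


section \<open>The idempotent\<close>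

definition pairs :: "nat \<Rightarrow> nat set \<Rightarrow> nat set" where
  "pairs p L = L \<union> (+) p ` L"

text \<open>\<open>(-1)\<^bsup>m(m-1)/2\<^esup>\<close>, the sign that sorts \<open>(e\<^bsub>j1\<^esub> e\<^bsub>p+j1\<^esub>) \<cdots> (e\<^bsub>jm\<^esub> e\<^bsub>p+jm\<^esub>)\<close>.\<close>

definition pair_sign :: "nat \<Rightarrow> real" where
  "pair_sign m = (\<Prod>i<m. (- 1) ^ i)"

text \<open>The coefficients of \<open>\<Prod>\<^sub>j (1 + e\<^sub>j e\<^bsub>p+j\<^esub>) / 2\<close>.\<close>

definition kahler_idem :: "nat \<Rightarrow> multivector" where
  "kahler_idem p = (\<lambda>K. if \<exists>L\<subseteq>{1..p}. K = pairs p L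
     then pair_sign (card (K \<inter> {1..p})) / 2 ^ p else 0)"

section \<open>Signs and index sets of the pairs \<open>{j, p + j}\<close>\<close>

lemma pair_sign_simps: "pair_sign 0 = 1" "pair_sign (Suc m) = (- 1) ^ m * pair_sign m"
  by (simp_all add: pair_sign_def)

lemma pair_sign_square [simp]: "pair_sign m * pair_sign m = 1"
  by (induction m) (simp_all add: pair_sign_simps, simp add: algebra_simps flip: power_add mult_2)

lemma pairs_simps:
  "pairs p {} = {}" "pairs p {j} = {j, p + j}" "pairs p (insert j L) = {j, p + j} \<union> pairs p L"
  by (auto simp: pairs_def)

lemma pairs_Int: "L \<subseteq> {1..p} \<Longrightarrow> pairs p L \<inter> {1..p} = L"
  by (auto simp: pairs_def)

lemma pairs_subset: "L \<subseteq> {1..p} \<Longrightarrow> pairs p L \<subseteq> {1..2 * p}"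
  by (force simp: pairs_def)

lemma pair_in_pairs:
  assumes "j \<in> {1..p}" "L \<subseteq> {1..p}"
  shows "j \<in> pairs p L \<longleftrightarrow> j \<in> L" "p + j \<in> pairs p L \<longleftrightarrow> j \<in> L"
  using assms by (auto simp: pairs_def)

lemma sym_diff_pairs:
  assumes "j \<in> {1..p}" "L \<subseteq> {1..p}"
  shows "sym_diff {j, p + j} (pairs p L) = pairs p (sym_diff {j} L)"
  using assms by (auto simp: pairs_def)

lemma card_pairs:
  assumes "L \<subseteq> {1..p}"
  shows "card (pairs p L) = 2 * card L"
proof -
  have "finite L" using assms by (rule finite_subset) simp
  moreover have "{1..p} \<inter> (+) p ` {1..p} = {}" by auto
  then have "L \<inter> (+) p ` L = {}" using assms by blast
  ultimately have "card (pairs p L) = card L + card ((+) p ` L)"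
    unfolding pairs_def by (intro card_Un_disjoint) simp_all
  then show ?thesis by (simp add: card_image)
qed

text \<open>The sign is multiplicative over symmetric differences, so the pairs can be treated one
  at a time. Two pairs have one or three inversions (one if they coincide), hence each contributes
  -1.\<close>

lemma reorder_sign_pairs:
  assumes "j \<in> {1..p}" "L \<subseteq> {1..p}"
  shows "reorder_sign {j, p + j} (pairs p L) = (- 1) ^ card L"
proof -
  have "finite L" using assms(2) by (rule finite_subset) simp
  then show ?thesis using assms(2)
  proof (induction L rule: finite_induct)
    case empty
    then show ?case by (simp add: pairs_simps reorder_sign_def)
  next
    case (insert k L)
    have kL: "pairs p (insert k L) = sym_diff {k, p + k} (pairs p L)"
      using insert.hyps insert.prems by (subst sym_diff_pairs) (auto simp: Un_absorb2)
    have "reorder_sign {j, p + j} {k, p + k} = - 1"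
      using assms(1) insert.prems
      by (cases j k rule: linorder_cases) (simp_all add: reorder_sign_prod)
    moreover have "finite (pairs p L)" using insert.hyps by (simp add: pairs_def)
    ultimately show ?case
      unfolding kL using insert by (subst reorder_sign_sym_diff_right) simp_all
  qed
qed

text \<open>\<open>Q\<close> is left general so that the formula serves both algebras: for
  \<open>j\<close> in \<open>L\<close> the last factor is -1 in the Clifford algebra and 0 in the
  exterior algebra.\<close>

lemma basis_coeff_pairs:
  assumes "j \<in> {1..p}" "L \<subseteq> {1..p}"
  shows "basis_coeff Q {j, p + j} (pairs p L)
    = (- 1) ^ card L * (if j \<in> L then Q j * Q (p + j) else 1)"
proof -
  have "{j, p + j} \<inter> pairs p L = (if j \<in> L then {j, p + j} else {})"
    using pair_in_pairs[OF assms] by auto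
  then show ?thesis using assms by (simp add: basis_coeff_def reorder_sign_pairs)
qed

lemma kahler_idem_pairs:
  assumes "L \<subseteq> {1..p}"
  shows "kahler_idem p (pairs p L) = pair_sign (card L) / 2 ^ p"
  unfolding kahler_idem_def using assms by (subst if_P) (blast, simp only: pairs_Int[OF assms])

lemma kahler_idem_support: "kahler_idem p K \<noteq> 0 \<Longrightarrow> \<exists>L\<subseteq>{1..p}. K = pairs p L"
  by (auto simp: kahler_idem_def split: if_splits)

lemma kahler_idem_closed: "2 * p \<le> n \<Longrightarrow> kahler_idem p \<in> carrier (diag_clifford n Q)"
proof -
  assume n: "2 * p \<le> n"
  have "K \<subseteq> {1..n}" if "kahler_idem p K \<noteq> 0" for K
    using kahler_idem_support[OF that] pairs_subset[of _ p] n
    by (metis atLeastatMost_subset_iff dual_order.trans le_refl)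
  then show ?thesis by (auto simp: diag_clifford_simps(1))
qed

definition clifford_sign :: "nat \<Rightarrow> nat \<Rightarrow> real" where
  "clifford_sign p = (\<lambda>i. if i \<le> p then 1 else - 1)"

lemma minus_one_power_cancel: "(- 1) ^ m * ((- 1) ^ m * x) = (x :: real)"
  by (cases "even m") simp_all

lemma clifford_eq: "clifford p q = diag_clifford (p + q) (clifford_sign p)"
  by (simp add: clifford_def clifford_sign_def)

lemma ring_clifford: "ring (clifford p q)"
  unfolding clifford_eq by (rule ring_diag_clifford)

lemma clifford_mult_closed: "x \<otimes>\<^bsub>clifford p q\<^esub> y \<in> carrier (clifford p q)"
  unfolding clifford_eq by (rule diag_clifford_mult_closed)

text \<open>Symmetric difference with a pair is an involution, so one direction gives the
  other.\<close>

lemma sym_diff_is_pairs_iff: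
  assumes "j \<in> {1..p}"
  shows "(\<exists>L\<subseteq>{1..p}. sym_diff {j, p + j} K = pairs p L) \<longleftrightarrow> (\<exists>L\<subseteq>{1..p}. K = pairs p L)"
proof -
  have *: "\<exists>M\<subseteq>{1..p}. sym_diff {j, p + j} (pairs p L) = pairs p M" if "L \<subseteq> {1..p}" for L
  proof (intro exI conjI)
    show "sym_diff {j} L \<subseteq> {1..p}" using that assms by auto
    show "sym_diff {j, p + j} (pairs p L) = pairs p (sym_diff {j} L)"
      using assms that by (rule sym_diff_pairs)
  qed
  show ?thesis
  proof (intro iffI; elim exE conjE)
    fix L assume L: "L \<subseteq> {1..p}" "sym_diff {j, p + j} K = pairs p L"
    have "K = sym_diff {j, p + j} (sym_diff {j, p + j} K)" by auto
    then show "\<exists>L\<subseteq>{1..p}. K = pairs p L" using *[OF L(1)] unfolding L(2) by (simp only:)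
  next
    fix L assume L: "L \<subseteq> {1..p}" "K = pairs p L"
    show "\<exists>L\<subseteq>{1..p}. sym_diff {j, p + j} K = pairs p L" unfolding L(2) by (rule *[OF L(1)])
  qed
qed

section \<open>Action of the involutions on the idempotent\<close>

text \<open>Behind this is \<open>u_j (1 + u_j) = 1 + u_j\<close>, which holds since
  \<open>u_j\<close> squares to \<open>- e_j^2 e_{p+j}^2 = 1\<close>. On coefficients,
  \<open>u_j\<close> moves \<open>j\<close> into or out of \<open>L\<close>.\<close>

lemma pair_mult_kahler_idem:
  assumes "p \<le> q" "j \<in> {1..p}"
  shows "blade {j, p + j} \<otimes>\<^bsub>clifford p q\<^esub> kahler_idem p = kahler_idem p"
proof
  fix K
  let ?J = "{j, p + j}"
  have J: "?J \<subseteq> {1..p + q}" and f: "kahler_idem p \<in> carrier (clifford p q)"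
    using assms by (auto simp: clifford_eq intro: kahler_idem_closed)
  have eq: "(blade ?J \<otimes>\<^bsub>clifford p q\<^esub> kahler_idem p) K
      = basis_coeff (clifford_sign p) ?J (sym_diff ?J K) * kahler_idem p (sym_diff ?J K)"
    using f unfolding clifford_eq by (rule blade_mult_left[OF J])
  show "(blade ?J \<otimes>\<^bsub>clifford p q\<^esub> kahler_idem p) K = kahler_idem p K"
  proof (cases "\<exists>L\<subseteq>{1..p}. K = pairs p L")
    case True
    then obtain L where L: "L \<subseteq> {1..p}" "K = pairs p L" by auto
    define M where "M = sym_diff {j} L"
    have M: "M \<subseteq> {1..p}" "sym_diff ?J K = pairs p M" "finite M" "finite L"
      using L assms(2) finite_subset[of L "{1..p}"]
      by (auto simp: M_def sym_diff_pairs simp del: One_nat_def)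
    have L_eq: "L = (if j \<in> M then M - {j} else insert j M)"
      by (auto simp: M_def)
    \<comment> \<open>The power comes from reordering and the conditional -1 from the squares of
      \<open>e_j\<close> and \<open>e_{p+j}\<close>. Together they are the ratio of two consecutive
      values of \<open>pair_sign\<close>.\<close>
    have "(- 1) ^ card M * (if j \<in> M then - 1 else 1) * pair_sign (card M) = pair_sign (card L)"
    proof (cases "j \<in> M")
      case True
      then have "card M = Suc (card L)" using L_eq M(3) by (metis card.remove)
      then show ?thesis using True by (simp add: pair_sign_simps minus_one_power_cancel)
    next
      case False
      then have "card L = Suc (card M)" using L_eq M(3) by simp
      then show ?thesis using False by (simp add: pair_sign_simps)
    qed
    moreover have "clifford_sign p j * clifford_sign p (p + j) = - 1"
      using assms(2) by (simp add: clifford_sign_def)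
    ultimately show ?thesis
      unfolding eq M(2)
      unfolding L(2) kahler_idem_pairs[OF M(1)] kahler_idem_pairs[OF L(1)]
        basis_coeff_pairs[OF assms(2) M(1)] by (simp only: mult.assoc times_divide_eq_right)
  next
    case False
    then have "\<not> (\<exists>L\<subseteq>{1..p}. sym_diff ?J K = pairs p L)"
      using assms(2) by (simp only: sym_diff_is_pairs_iff not_False_eq_True)
    then have "kahler_idem p (sym_diff ?J K) = 0" "kahler_idem p K = 0"
      using False kahler_idem_support by blast+
    then show ?thesis unfolding eq by (simp only: mult_zero_right)
  qed
qed

text \<open>Every index set in the support of the idempotent contains both or neither of
  \<open>j\<close> and \<open>p + j\<close>, so the sign in \<open>mult_even_blade\<close> is +1
  there.\<close>

lemma kahler_idem_mult_pair:
  assumes "p \<le> q" "j \<in> {1..p}"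
  shows "kahler_idem p \<otimes>\<^bsub>clifford p q\<^esub> blade {j, p + j} = kahler_idem p"
proof
  fix K
  let ?J = "{j, p + j}"
  have J: "?J \<subseteq> {1..p + q}" "even (card ?J)" and f: "kahler_idem p \<in> carrier (clifford p q)"
    using assms by (auto simp: clifford_eq intro: kahler_idem_closed)
  have "(kahler_idem p \<otimes>\<^bsub>clifford p q\<^esub> blade ?J) K = (- 1) ^ card (?J \<inter> K) * kahler_idem p K"
    using pair_mult_kahler_idem[OF assms] f unfolding clifford_eq
    by (simp add: mult_even_blade[OF J])
  also have "\<dots> = kahler_idem p K"
  proof (cases "kahler_idem p K = 0")
    case False
    then obtain L where L: "L \<subseteq> {1..p}" "K = pairs p L" using kahler_idem_support by blast
    have "?J \<inter> K = (if j \<in> L then ?J else {})"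
      using pair_in_pairs[OF assms(2) L(1)] L(2) by auto
    then show ?thesis using assms(2) by simp
  qed simp
  finally show "(kahler_idem p \<otimes>\<^bsub>clifford p q\<^esub> blade ?J) K = kahler_idem p K" .
qed

text \<open>Up to the sorting sign, the basis element of \<open>pairs p L\<close> is the product of
  the \<open>u_j\<close> with \<open>j\<close> in \<open>L\<close>, each of which fixes
  \<open>x\<close>.\<close>

lemma blade_pairs_mult:
  assumes "p \<le> q" "x \<in> carrier (clifford p q)" "L \<subseteq> {1..p}"
    and "\<And>j. j \<in> {1..p} \<Longrightarrow> blade {j, p + j} \<otimes>\<^bsub>clifford p q\<^esub> x = x"
  shows "blade (pairs p L) \<otimes>\<^bsub>clifford p q\<^esub> x = pair_sign (card L) \<odot>\<^bsub>clifford p q\<^esub> x"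
proof -
  have "finite L" using assms(3) by (rule finite_subset) simp
  then show ?thesis using assms(3)
  proof (induction L rule: finite_induct)
    case empty
    have "blade (pairs p {}) = \<one>\<^bsub>clifford p q\<^esub>"
      by (auto simp: blade_def pairs_simps clifford_eq diag_clifford_simps)
    then have "blade (pairs p {}) \<otimes>\<^bsub>clifford p q\<^esub> x = x"
      using assms(2) by (simp only: clifford_eq diag_clifford_one_mult(1))
    then show ?case by (auto simp: clifford_eq diag_clifford_simps(6) pair_sign_simps)
  next
    case (insert j L)
    let ?J = "{j, p + j}" and ?C = "clifford p q"
    have J: "?J \<subseteq> {1..p + q}" "pairs p L \<subseteq> {1..p + q}"
      using insert.prems assms(1) pairs_subset[of L p]
      by (auto simp del: atLeastAtMost_iff) auto
    have "pairs p (insert j L) = sym_diff ?J (pairs p L)"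
      using insert.hyps insert.prems by (subst sym_diff_pairs) (auto simp: Un_absorb2)
    then have "blade ?J \<otimes>\<^bsub>?C\<^esub> blade (pairs p L) =
        (- 1) ^ card L \<odot>\<^bsub>?C\<^esub> blade (pairs p (insert j L))"
      unfolding clifford_eq blade_mult[OF J]
      using insert.hyps insert.prems by (simp add: basis_coeff_pairs)
    then have "(- 1) ^ card L \<odot>\<^bsub>?C\<^esub> (blade (pairs p (insert j L)) \<otimes>\<^bsub>?C\<^esub> x)
        = blade ?J \<otimes>\<^bsub>?C\<^esub> (blade (pairs p L) \<otimes>\<^bsub>?C\<^esub> x)"
      unfolding clifford_eq diag_clifford_smult(1) by (simp flip: diag_clifford_mult_assoc)
    also have "\<dots> = pair_sign (card L) \<odot>\<^bsub>?C\<^esub> x"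
      using insert assms(4)[of j] unfolding clifford_eq by (simp flip: diag_clifford_smult(2))
    finally have *: "(- 1) ^ card L * (blade (pairs p (insert j L)) \<otimes>\<^bsub>?C\<^esub> x) K
        = pair_sign (card L) * x K" for K
      unfolding clifford_eq fun_eq_iff diag_clifford_simps(6) by blast
    \<comment> \<open>Multiplying by the same sign twice isolates the product, which
      \<open>*\<close> determines only up to that sign.\<close>
    have "(blade (pairs p (insert j L)) \<otimes>\<^bsub>?C\<^esub> x) K
        = (- 1) ^ card L * ((- 1) ^ card L * (blade (pairs p (insert j L)) \<otimes>\<^bsub>?C\<^esub> x) K)" for K
      by (simp only: minus_one_power_cancel)
    then show ?case
      unfolding * using insert.hyps
      by (auto simp: clifford_eq diag_clifford_simps(6) pair_sign_simps)
  qed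
qed

text \<open>Each of the \<open>2 ^ p\<close> basis elements in the support of \<open>f\<close>
  contributes \<open>x / 2 ^ p\<close>, because its coefficient sign cancels against the sign in
  \<open>blade_pairs_mult\<close>. Taking \<open>x = f\<close> gives idempotence.\<close>

lemma kahler_idem_mult_left:
  assumes "p \<le> q" "x \<in> carrier (clifford p q)"
    and "\<And>j. j \<in> {1..p} \<Longrightarrow> blade {j, p + j} \<otimes>\<^bsub>clifford p q\<^esub> x = x"
  shows "kahler_idem p \<otimes>\<^bsub>clifford p q\<^esub> x = x"
proof
  fix K
  have inj: "inj_on (pairs p) (Pow {1..p})"
    by (rule inj_on_inverseI[of _ "\<lambda>K. K \<inter> {1..p}"]) (metis pairs_Int PowD)
  have f: "kahler_idem p \<in> carrier (clifford p q)"
    using assms(1) by (auto simp: clifford_eq intro: kahler_idem_closed)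
  have "(kahler_idem p \<otimes>\<^bsub>clifford p q\<^esub> x) K
      = (\<Sum>I\<in>Pow {1..p + q}. kahler_idem p I * (blade I \<otimes>\<^bsub>clifford p q\<^esub> x) K)"
    using f assms(2) unfolding clifford_eq by (rule diag_clifford_mult_expand)
  also have "\<dots> = (\<Sum>I\<in>pairs p ` Pow {1..p}. kahler_idem p I * (blade I \<otimes>\<^bsub>clifford p q\<^esub> x) K)"
  proof (rule sum.mono_neutral_right)
    have "{1..2 * p} \<subseteq> {1..p + q}" using assms(1) by auto
    then show "pairs p ` Pow {1..p} \<subseteq> Pow {1..p + q}"
      using pairs_subset by blast
    show "\<forall>i\<in>Pow {1..p + q} - pairs p ` Pow {1..p}.
       kahler_idem p i * (blade i \<otimes>\<^bsub>clifford p q\<^esub> x) K = 0"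
    proof
      fix I assume "I \<in> Pow {1..p + q} - pairs p ` Pow {1..p}"
      then have "kahler_idem p I = 0" using kahler_idem_support by blast
      then show "kahler_idem p I * (blade I \<otimes>\<^bsub>clifford p q\<^esub> x) K = 0" by simp
    qed
  qed simp
  also have "\<dots> = (\<Sum>L\<in>Pow {1..p}. kahler_idem p (pairs p L) * (blade (pairs p L) \<otimes>\<^bsub>clifford p q\<^esub> x) K)"
    unfolding sum.reindex[OF inj] comp_def ..
  also have "\<dots> = (\<Sum>L\<in>Pow {1..p}. x K / 2 ^ p)"
  proof (intro sum.cong refl)
    fix L assume "L \<in> Pow {1..p}"
    then have L: "L \<subseteq> {1..p}" by simp
    have "blade (pairs p L) \<otimes>\<^bsub>clifford p q\<^esub> x = pair_sign (card L) \<odot>\<^bsub>clifford p q\<^esub> x"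
      by (rule blade_pairs_mult[OF assms(1,2) L assms(3)])
    then have "kahler_idem p (pairs p L) * (blade (pairs p L) \<otimes>\<^bsub>clifford p q\<^esub> x) K
       = (pair_sign (card L) * pair_sign (card L)) * x K / 2 ^ p"
      unfolding kahler_idem_pairs[OF L] by (simp add: clifford_eq diag_clifford_simps(6))
    then show "kahler_idem p (pairs p L) * (blade (pairs p L) \<otimes>\<^bsub>clifford p q\<^esub> x) K = x K / 2 ^ p"
      by simp
  qed
  also have "\<dots> = x K" by (simp add: card_Pow)
  finally show "(kahler_idem p \<otimes>\<^bsub>clifford p q\<^esub> x) K = x K" .
qed

lemma idempotent_kahler_idem:
  assumes "p \<le> q"
  shows "idempotent (clifford p q) (kahler_idem p)"
  unfolding idempotent_def
proof
  show f: "kahler_idem p \<in> carrier (clifford p q)"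
    using assms by (auto simp: clifford_eq intro: kahler_idem_closed)
  show "kahler_idem p \<otimes>\<^bsub>clifford p q\<^esub> kahler_idem p = kahler_idem p"
    by (rule kahler_idem_mult_left[OF assms f pair_mult_kahler_idem[OF assms]])
qed

lemma kahler_idem_empty: "kahler_idem p {} = 1 / 2 ^ p"
  using kahler_idem_pairs[of "{}" p] by (simp add: pairs_simps pair_sign_simps)

text \<open>If \<open>K\<close> contains exactly one index of a pair, the left and right actions
  have opposite signs at \<open>K\<close> and force \<open>w K = - w K\<close>. If \<open>K\<close>
  contains a whole pair, left invariance reduces \<open>w K\<close> to the coefficient with the pair
  removed, which has fewer indices in \<open>{1..p}\<close>. Otherwise \<open>zero\<close>
  applies.\<close>

lemma pair_invariant_eq_zero:
  assumes "p \<le> q" "w \<in> carrier (clifford p q)"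
    and left: "\<And>j. j \<in> {1..p} \<Longrightarrow> blade {j, p + j} \<otimes>\<^bsub>clifford p q\<^esub> w = w"
    and right: "\<And>j. j \<in> {1..p} \<Longrightarrow> w \<otimes>\<^bsub>clifford p q\<^esub> blade {j, p + j} = w"
    and zero: "\<And>K. K \<subseteq> {2 * p + 1..p + q} \<Longrightarrow> w K = 0"
  shows "w K = 0"
proof (induction "card (K \<inter> {1..p})" arbitrary: K rule: less_induct)
  case less
  show "w K = 0"
  proof (cases "K \<subseteq> {1..p + q}")
    case outside: False
    then show ?thesis using assms(2) carrier_outside by (auto simp: clifford_eq)
  next
    case K: True
    show ?thesis
    proof (cases "K \<inter> {1..2 * p} = {}")
      case True
      then have "K \<subseteq> {2 * p + 1..p + q}" using K by force
      then show ?thesis by (rule zero)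
    next
      case False
      then obtain i where i: "i \<in> K" "1 \<le> i" "i \<le> 2 * p" by auto
      define j where "j = (if i \<le> p then i else i - p)"
      have j: "j \<in> {1..p}" and iJ: "i \<in> {j, p + j}" using i by (auto simp: j_def)
      let ?J = "{j, p + j}"
      have J: "?J \<subseteq> {1..p + q}" "even (card ?J)" using j assms(1) by auto
      show ?thesis
      proof (cases "?J \<subseteq> K")
        case True
        have "sym_diff ?J K = K - ?J" using True by blast
        then have "sym_diff ?J K \<inter> {1..p} \<subset> K \<inter> {1..p}" using True j by blast
        then have "card (sym_diff ?J K \<inter> {1..p}) < card (K \<inter> {1..p})"
          by (intro psubset_card_mono) auto
        then have "w (sym_diff ?J K) = 0" by (rule less)
        then have "(blade ?J \<otimes>\<^bsub>clifford p q\<^esub> w) K = 0"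
          using assms(2) J(1) unfolding clifford_eq by (simp add: blade_mult_left)
        then show ?thesis using left[OF j] by simp
      next
        case False
        have "?J \<inter> K = {i}" using False iJ i(1) by auto
        then have "(w \<otimes>\<^bsub>clifford p q\<^esub> blade ?J) K = - (blade ?J \<otimes>\<^bsub>clifford p q\<^esub> w) K"
          using assms(2) J unfolding clifford_eq by (simp add: mult_even_blade)
        then show ?thesis unfolding left[OF j] right[OF j] by simp
      qed
    qed
  qed
qed


section \<open>Minimality of the left ideal\<close>

text \<open>
  This is \<open>d\<^sup>* d = \<Sum>\<^sub>I z\<^sub>I\<^sup>2\<close> for the conjugate \<open>d\<^sup>*\<close> of an element \<open>d\<close> of \<open>\<real>\<^bsub>0,k\<^esub>\<close>, \<open>k \<le> 2\<close>, that is
  of \<open>\<real>\<close>, \<open>\<complex>\<close> or the quaternions; it fails for \<open>k = 3\<close>.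
\<close>

lemma conjugate_mult_coeff:
  assumes "p \<le> q" "q \<le> p + 2" "K \<subseteq> {2 * p + 1..p + q}"
  shows "(\<Sum>I\<in>Pow {2 * p + 1..p + q}. basis_coeff (clifford_sign p) I (sym_diff I K)
        * ((if I = {} then 1 else - 1) * z I) * z (sym_diff I K))
    = (if K = {} then \<Sum>I\<in>Pow {2 * p + 1..p + q}. (z I)\<^sup>2 else 0)"
proof -
  define a where "a = 2 * p + 1"
  have "q = p \<or> q = p + 1 \<or> q = p + 2" using assms(1,2) by auto
  then have T: "{2 * p + 1..p + q} = {} \<or> {2 * p + 1..p + q} = {a} \<or> {2 * p + 1..p + q} = {a, Suc a}"
    by (auto simp: a_def)
  have Q: "clifford_sign p a = - 1" "clifford_sign p (Suc a) = - 1"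
    by (auto simp: a_def clifford_sign_def)
  have D: "{a, Suc a} - {a} = {Suc a}" "{a, Suc a} - {Suc a} = {a}" "{a} - {a, Suc a} = {}"
    "{Suc a} - {a, Suc a} = {}" "{a} - {Suc a} = {a}" "{Suc a} - {a} = {Suc a}"
    "{Suc a, a} = {a, Suc a}"
    "{a} \<noteq> {a, Suc a}" "{Suc a} \<noteq> {a, Suc a}" "{a, Suc a} \<noteq> {a}" "{a, Suc a} \<noteq> {Suc a}" by auto
  \<comment> \<open>This is the quaternion table with \<open>i = e_a\<close>,
    \<open>j = e_{a+1}\<close> and \<open>k = e_a e_{a+1}\<close>; the first entry alone covers the
    complex numbers.\<close>
  have C: "basis_coeff (clifford_sign p) {a} {a} = - 1"
    "basis_coeff (clifford_sign p) {Suc a} {Suc a} = - 1"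
    "basis_coeff (clifford_sign p) {a, Suc a} {a, Suc a} = - 1"
    "basis_coeff (clifford_sign p) {a} {Suc a} = 1"
    "basis_coeff (clifford_sign p) {Suc a} {a} = - 1"
    "basis_coeff (clifford_sign p) {a} {a, Suc a} = - 1"
    "basis_coeff (clifford_sign p) {a, Suc a} {a} = 1"
    "basis_coeff (clifford_sign p) {Suc a} {a, Suc a} = 1"
    "basis_coeff (clifford_sign p) {a, Suc a} {Suc a} = - 1"
    by (simp_all add: basis_coeff_def reorder_sign_prod Q)
  from T show ?thesis
  proof (elim disjE)
    assume *: "{2 * p + 1..p + q} = {}"
    then show ?thesis using assms(3) unfolding * by (simp add: power2_eq_square)
  next
    assume *: "{2 * p + 1..p + q} = {a}"
    then have "K = {} \<or> K = {a}" using assms(3) unfolding * by blast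
    then show ?thesis unfolding * by (auto simp: Pow_insert C power2_eq_square)
  next
    assume *: "{2 * p + 1..p + q} = {a, Suc a}"
    have P: "Pow {a, Suc a} = {{}, {a}, {Suc a}, {a, Suc a}}"
      by (auto simp: Pow_insert)
    have "K \<in> Pow {a, Suc a}" using assms(3) unfolding * by simp
    then show ?thesis
      unfolding * P by (elim insertE emptyE) (simp_all add: C D power2_eq_square)
  qed
qed

text \<open>This provides the hypothesis \<open>gen\<close> of
  \<open>minimal_left_ideal_left_multiples\<close>. The bound \<open>q \<le> p + 2\<close> enters
  through \<open>conjugate_mult_coeff\<close>.\<close>

lemma kahler_idem_mem_left_ideal:
  assumes "p \<le> q" "q \<le> p + 2"
    and x: "x \<in> carrier (clifford p q)" "x \<otimes>\<^bsub>clifford p q\<^esub> kahler_idem p = x"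
      "x \<noteq> \<zero>\<^bsub>clifford p q\<^esub>"
  shows "\<exists>a\<in>carrier (clifford p q). a \<otimes>\<^bsub>clifford p q\<^esub> x = kahler_idem p"
proof -
  interpret ring "clifford p q" by (rule ring_clifford)
  let ?C = "clifford p q" and ?f = "kahler_idem p" and ?T = "{2 * p + 1..p + q}"
  note smult = diag_clifford_smult[where n = "p + q" and Q = "clifford_sign p", folded clifford_eq]
    and smult_apply = diag_clifford_simps(6)[where n = "p + q" and Q = "clifford_sign p", folded clifford_eq]
    and add_apply = diag_clifford_simps(5)[where n = "p + q" and Q = "clifford_sign p", folded clifford_eq]
    and closed = clifford_mult_closed
  have f: "?f \<in> carrier ?C" using assms(1) by (auto simp: clifford_eq intro: kahler_idem_closed)
  have smult_closed: "c \<odot>\<^bsub>?C\<^esub> y \<in> carrier ?C" if "y \<in> carrier ?C" for c y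
    using that by (auto simp: clifford_eq diag_clifford_simps(1,6))
  obtain K where K: "x K \<noteq> 0" "K \<subseteq> {1..p + q}"
    using x(1,3) by (auto simp: clifford_eq diag_clifford_simps(1,4) fun_eq_iff)
  have bK: "blade K \<in> carrier ?C" unfolding clifford_eq by (rule blade_closed[OF K(2)])
  \<comment> \<open>Multiplication by \<open>e_K\<close> brings the nonzero coefficient of
    \<open>x\<close> at \<open>K\<close> to the position of 1, up to sign. Multiplying by
    \<open>f\<close> from the left then adds invariance under the \<open>u_j\<close> on that
    side.\<close>
  define y where "y = blade K \<otimes>\<^bsub>?C\<^esub> x"
  define z where "z = ?f \<otimes>\<^bsub>?C\<^esub> y"
  have yz: "y \<in> carrier ?C" "z \<in> carrier ?C" by (simp_all add: y_def z_def closed)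
  have yf: "y \<otimes>\<^bsub>?C\<^esub> ?f = y" unfolding y_def using bK x(1,2) f by (simp add: m_assoc)
  \<comment> \<open>The coefficient of \<open>1\<close> is a trace, so that it does not distinguish \<open>f y\<close> from \<open>y f = y\<close>.\<close>
  have "z {} = (y \<otimes>\<^bsub>?C\<^esub> ?f) {}"
    unfolding z_def using f yz(1) unfolding clifford_eq by (rule mult_coeff_empty_commute)
  also have "\<dots> = basis_coeff (clifford_sign p) K K * x K"
    unfolding yf unfolding y_def clifford_eq
    using K(2) x(1)[unfolded clifford_eq] by (simp add: blade_mult_left)
  also have "\<dots> \<noteq> 0"
    using K finite_subset[OF K(2)]
    by (auto simp: basis_coeff_def reorder_sign_def clifford_sign_def)
  finally have z0: "z {} \<noteq> 0" .
  have left: "blade {j, p + j} \<otimes>\<^bsub>?C\<^esub> z = z" and right: "z \<otimes>\<^bsub>?C\<^esub> blade {j, p + j} = z"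
    and uc: "blade {j, p + j} \<in> carrier ?C"
    if j: "j \<in> {1..p}" for j
  proof -
    show u: "blade {j, p + j} \<in> carrier ?C"
      unfolding clifford_eq using j assms(1) by (intro blade_closed) auto
    show "blade {j, p + j} \<otimes>\<^bsub>?C\<^esub> z = z"
      unfolding z_def using f yz(1) u pair_mult_kahler_idem[OF assms(1) j] by (simp flip: m_assoc)
    have "y \<otimes>\<^bsub>?C\<^esub> blade {j, p + j} = y \<otimes>\<^bsub>?C\<^esub> ?f \<otimes>\<^bsub>?C\<^esub> blade {j, p + j}" by (simp only: yf)
    also have "\<dots> = y \<otimes>\<^bsub>?C\<^esub> (?f \<otimes>\<^bsub>?C\<^esub> blade {j, p + j})"
      using yz(1) f u by (rule m_assoc)
    also have "\<dots> = y" by (simp only: kahler_idem_mult_pair[OF assms(1) j] yf)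
    finally show "z \<otimes>\<^bsub>?C\<^esub> blade {j, p + j} = z"
      unfolding z_def using f yz(1) u by (simp only: m_assoc)
  qed
  \<comment> \<open>The Clifford conjugate of the part of \<open>z\<close> in the generators beyond
    \<open>2 * p\<close>: conjugation changes the sign in degrees 1 and 2, the only positive degrees
    that occur there.\<close>
  define d where "d = (\<lambda>I. if I \<subseteq> ?T then (if I = {} then 1 else - 1) * z I else 0)"
  have T: "?T \<subseteq> {1..p + q}" by auto
  then have d: "d \<in> carrier ?C"
    by (auto simp: d_def clifford_eq diag_clifford_simps(1) split: if_splits)
  define N where "N = (\<Sum>I\<in>Pow ?T. (z I)\<^sup>2)"
  have N: "N > 0" unfolding N_def using z0 by (intro sum_pos2[of _ "{}"]) auto
  \<comment> \<open>The factor \<open>2 ^ p\<close> compensates for the coefficient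
    \<open>1 / 2 ^ p\<close> of \<open>f\<close> at 1. Showing \<open>v = 0\<close> identifies
    \<open>d z\<close> as a positive multiple of \<open>f\<close>.\<close>
  define v where "v = d \<otimes>\<^bsub>?C\<^esub> z \<oplus>\<^bsub>?C\<^esub> (- (2 ^ p * N)) \<odot>\<^bsub>?C\<^esub> ?f"
  have "v L = 0" for L
  proof (rule pair_invariant_eq_zero[OF assms(1)])
    show "v \<in> carrier ?C" by (simp add: v_def closed smult_closed f)
  next
    fix j assume j: "j \<in> {1..p}"
    let ?u = "blade {j, p + j}"
    have J: "{j, p + j} \<subseteq> {1..p + q}" "even (card {j, p + j})" using j assms(1) by auto
    \<comment> \<open>The index sets of \<open>d\<close> avoid both indices of the pair, so every
      set in the support of \<open>u_j d\<close> contains the whole pair and the commutation sign is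
      +1.\<close>
    have du: "d \<otimes>\<^bsub>?C\<^esub> ?u = ?u \<otimes>\<^bsub>?C\<^esub> d"
    proof
      fix L
      have l: "(?u \<otimes>\<^bsub>?C\<^esub> d) L
          = basis_coeff (clifford_sign p) {j, p + j} (sym_diff {j, p + j} L) * d (sym_diff {j, p + j} L)"
        using d unfolding clifford_eq by (rule blade_mult_left[OF J(1)])
      have r: "(d \<otimes>\<^bsub>?C\<^esub> ?u) L = (- 1) ^ card ({j, p + j} \<inter> L) * (?u \<otimes>\<^bsub>?C\<^esub> d) L"
        using d unfolding clifford_eq by (rule mult_even_blade[OF J])
      show "(d \<otimes>\<^bsub>?C\<^esub> ?u) L = (?u \<otimes>\<^bsub>?C\<^esub> d) L"
      proof (cases "sym_diff {j, p + j} L \<subseteq> ?T")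
        case True
        have "{j, p + j} \<inter> ?T = {}" using j by auto
        then have "{j, p + j} \<inter> L = {j, p + j}" using True by blast
        then show ?thesis using j unfolding r by simp
      next
        case False
        then have "d (sym_diff {j, p + j} L) = 0" unfolding d_def by (rule if_not_P)
        then show ?thesis unfolding r l by (simp only: mult_zero_right)
      qed
    qed
    show "?u \<otimes>\<^bsub>?C\<^esub> v = v"
    proof -
      have "?u \<otimes>\<^bsub>?C\<^esub> (d \<otimes>\<^bsub>?C\<^esub> z) = d \<otimes>\<^bsub>?C\<^esub> (?u \<otimes>\<^bsub>?C\<^esub> z)"
        using uc[OF j] d yz(2) du by (simp flip: m_assoc)
      then show ?thesis
        unfolding v_def using uc[OF j]
        by (simp add: r_distr closed smult_closed f left[OF j] pair_mult_kahler_idem[OF assms(1) j]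
            flip: smult(2))
    qed
    show "v \<otimes>\<^bsub>?C\<^esub> ?u = v"
      unfolding v_def using uc[OF j]
      by (simp add: l_distr closed smult_closed f m_assoc d yz right[OF j]
          kahler_idem_mult_pair[OF assms(1) j] flip: smult(1))
  next
    fix L assume L: "L \<subseteq> ?T"
    have "(d \<otimes>\<^bsub>?C\<^esub> z) L = (\<Sum>I\<in>Pow {1..p + q}.
        basis_coeff (clifford_sign p) I (sym_diff I L) * d I * z (sym_diff I L))"
      using d yz(2) unfolding clifford_eq by (rule diag_clifford_mult_eq)
    \<comment> \<open>As \<open>d\<close> is supported in \<open>?T\<close> and \<open>L\<close>
      lies in \<open>?T\<close>, only the coefficients of \<open>z\<close> inside \<open>?T\<close>
      enter, and the conjugate formula applies.\<close>
    also have "\<dots> = (\<Sum>I\<in>Pow ?T. basis_coeff (clifford_sign p) I (sym_diff I L)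
        * ((if I = {} then 1 else - 1) * z I) * z (sym_diff I L))"
      using T by (intro sum.mono_neutral_cong_right) (auto simp: d_def)
    also have "\<dots> = (if L = {} then N else 0)"
      unfolding N_def by (rule conjugate_mult_coeff[OF assms(1,2) L])
    also have "\<dots> = 2 ^ p * N * ?f L"
    proof (cases "L = {}")
      case False
      have "?f L = 0"
      proof (rule ccontr)
        assume "?f L \<noteq> 0"
        then obtain M where M: "M \<subseteq> {1..p}" "L = pairs p M" using kahler_idem_support by blast
        then have "M = L \<inter> {1..p}" by (simp only: pairs_Int)
        moreover have "?T \<inter> {1..p} = {}" by auto
        ultimately have "M = {}" using L by blast
        then show False using False M(2) by (simp add: pairs_simps)
      qed
      then show ?thesis using False by simp
    qed (simp add: kahler_idem_empty)
    finally show "v L = 0" by (simp add: v_def add_apply smult_apply)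
  qed
  then have dz: "(d \<otimes>\<^bsub>?C\<^esub> z) L = 2 ^ p * N * ?f L" for L
    by (simp add: v_def add_apply smult_apply)
  let ?a = "(1 / (2 ^ p * N)) \<odot>\<^bsub>?C\<^esub> (d \<otimes>\<^bsub>?C\<^esub> (?f \<otimes>\<^bsub>?C\<^esub> blade K))"
  have "?a \<otimes>\<^bsub>?C\<^esub> x = (1 / (2 ^ p * N)) \<odot>\<^bsub>?C\<^esub> (d \<otimes>\<^bsub>?C\<^esub> z)"
    using d f bK x(1) unfolding z_def y_def by (simp add: m_assoc flip: smult(1))
  also have "\<dots> = ?f" using N by (auto simp: smult_apply dz)
  finally show ?thesis using smult_closed closed by blast
qed

lemma minimal_left_ideal_kahler_idem:
  assumes "p \<le> q" "q \<le> p + 2"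
  shows "minimal_left_ideal (clifford p q) (left_multiples (clifford p q) (kahler_idem p))"
    and "primitive_idempotent (clifford p q) (kahler_idem p)"
proof -
  interpret ring "clifford p q" by (rule ring_clifford)
  have "kahler_idem p \<noteq> \<zero>\<^bsub>clifford p q\<^esub>"
    using kahler_idem_empty[of p] by (auto simp: clifford_eq diag_clifford_simps(4) dest: fun_cong)
  moreover from this show
    "minimal_left_ideal (clifford p q) (left_multiples (clifford p q) (kahler_idem p))"
    using idempotent_kahler_idem[OF assms(1)] kahler_idem_mem_left_ideal[OF assms]
    by (intro minimal_left_ideal_left_multiples)
  ultimately show "primitive_idempotent (clifford p q) (kahler_idem p)"
    using idempotent_kahler_idem[OF assms(1)]
    by (intro primitive_idempotent_if_minimal_left_ideal)
qed

section \<open>The rational Kaehler polynomial\<close>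

lemma gen_eq_blade: "gen i = blade {i}"
  by (simp add: gen_def blade_def)

lemma gen_mult_gen_pair:
  assumes "j \<in> {1..p}" "2 * p \<le> n"
  shows "gen j \<otimes>\<^bsub>diag_clifford n Q\<^esub> gen (p + j) = blade {j, p + j}"
proof -
  have "{j} \<inter> {p + j} = {}" "sym_diff {j} {p + j} = {j, p + j}" using assms by auto
  moreover have "basis_coeff Q {j} {p + j} = 1"
    using assms by (simp add: basis_coeff_def reorder_sign_prod)
  ultimately show ?thesis
    using assms unfolding gen_eq_blade
    by (subst blade_mult) (auto simp: diag_clifford_simps(6))
qed

lemma kahler_form_closed: "kahler_form p \<in> carrier (diag_clifford (2 * p) Q)"
  unfolding kahler_form_coeff diag_clifford_simps(1) by auto

lemma mult_kahler_form:
  assumes "x \<in> carrier (exterior (2 * p))"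
  shows "(x \<otimes>\<^bsub>exterior (2 * p)\<^esub> kahler_form p) K
    = (\<Sum>j\<in>{1..p}. (x \<otimes>\<^bsub>exterior (2 * p)\<^esub> blade {j, p + j}) K)"
proof -
  interpret ring "exterior (2 * p)" unfolding exterior_def by (rule ring_diag_clifford)
  let ?E = "exterior (2 * p)"
  have b: "blade {j, p + j} \<in> carrier ?E" if "j \<in> {1..p}" for j
    unfolding exterior_def using that by (intro blade_closed) auto
  have "kahler_form p = (\<Oplus>\<^bsub>?E\<^esub> j\<in>{1..p}. blade {j, p + j})"
    unfolding kahler_form_def
  proof (rule finsum_cong')
    fix j assume "j \<in> {1..p}"
    then show "gen j \<otimes>\<^bsub>?E\<^esub> gen (p + j) = blade {j, p + j}"
      unfolding exterior_def by (rule gen_mult_gen_pair) simp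
  qed (use b in auto)
  then have "x \<otimes>\<^bsub>?E\<^esub> kahler_form p = (\<Oplus>\<^bsub>?E\<^esub> j\<in>{1..p}. x \<otimes>\<^bsub>?E\<^esub> blade {j, p + j})"
    using assms b by (simp add: finsum_rdistr Pi_def)
  also have "\<dots> = (\<lambda>K. \<Sum>j\<in>{1..p}. (x \<otimes>\<^bsub>?E\<^esub> blade {j, p + j}) K)"
    unfolding exterior_def by (rule finsum_diag_clifford) (simp_all add: diag_clifford_mult_closed)
  finally show ?thesis by (rule fun_cong)
qed

text \<open>A set of \<open>m\<close> pairs arises from \<open>m!\<close> orders of the factors, all
  with the same sign because 2-forms commute. In the induction, the last factor can be any of the
  \<open>m + 1\<close> pairs in \<open>L\<close>.\<close>

lemma kahler_form_power:
  "kahler_form p [^]\<^bsub>exterior (2 * p)\<^esub> m = (\<lambda>K. if \<exists>L\<subseteq>{1..p}. K = pairs p L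
     then if card (K \<inter> {1..p}) = m then fact m * pair_sign m else 0 else 0)"
proof (induction m)
  case 0
  show ?case
  proof
    fix K
    have "(\<exists>L\<subseteq>{1..p}. K = pairs p L) \<and> card (K \<inter> {1..p}) = 0 \<longleftrightarrow> K = {}"
    proof
      assume *: "(\<exists>L\<subseteq>{1..p}. K = pairs p L) \<and> card (K \<inter> {1..p}) = 0"
      then obtain L where L: "L \<subseteq> {1..p}" "K = pairs p L" by blast
      then have "L = {}" using * pairs_Int[OF L(1)] by simp
      then show "K = {}" using L(2) by (simp add: pairs_simps)
    next
      assume "K = {}"
      moreover have "{} \<subseteq> {1..p} \<and> {} = pairs p {}" by (simp add: pairs_simps)
      ultimately show "(\<exists>L\<subseteq>{1..p}. K = pairs p L) \<and> card (K \<inter> {1..p}) = 0" by force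
    qed
    moreover have "(kahler_form p [^]\<^bsub>exterior (2 * p)\<^esub> (0 :: nat)) K
        = (if K = {} then fact 0 * pair_sign 0 else 0)"
      by (simp add: nat_pow_def exterior_def diag_clifford_simps(3) pair_sign_simps)
    ultimately show "(kahler_form p [^]\<^bsub>exterior (2 * p)\<^esub> (0 :: nat)) K = (if \<exists>L\<subseteq>{1..p}. K = pairs p L
        then if card (K \<inter> {1..p}) = 0 then fact 0 * pair_sign 0 else 0 else 0)"
      by (simp only: if_if_eq_conj)
  qed
next
  case (Suc m)
  let ?E = "exterior (2 * p)"
  let ?x = "kahler_form p [^]\<^bsub>?E\<^esub> m"
  have x: "?x \<in> carrier ?E"
  proof -
    interpret ring ?E unfolding exterior_def by (rule ring_diag_clifford)
    show ?thesis using kahler_form_closed unfolding exterior_def[symmetric]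
      by (intro nat_pow_closed) (simp add: exterior_def)
  qed
  show ?case
  proof
    fix K
    have "(kahler_form p [^]\<^bsub>?E\<^esub> Suc m) K = (?x \<otimes>\<^bsub>?E\<^esub> kahler_form p) K"
      by (simp add: nat_pow_def)
    also have "\<dots> = (\<Sum>j\<in>{1..p}. (?x \<otimes>\<^bsub>?E\<^esub> blade {j, p + j}) K)" by (rule mult_kahler_form[OF x])
    also have "\<dots> = (if \<exists>L\<subseteq>{1..p}. K = pairs p L
       then if card (K \<inter> {1..p}) = Suc m then fact (Suc m) * pair_sign (Suc m) else 0 else 0)"
    proof (cases "\<exists>L\<subseteq>{1..p}. K = pairs p L")
      case False
      have "(?x \<otimes>\<^bsub>?E\<^esub> blade {j, p + j}) K = 0" if j: "j \<in> {1..p}" for j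
      proof -
        have "{j, p + j} \<subseteq> {1..2 * p}" using j by auto
        then have "(?x \<otimes>\<^bsub>?E\<^esub> blade {j, p + j}) K =
          basis_coeff (\<lambda>_. 0) (sym_diff {j, p + j} K) {j, p + j} * ?x (sym_diff {j, p + j} K)"
          using x unfolding exterior_def by (rule blade_mult_right)
        moreover have "?x (sym_diff {j, p + j} K) = 0"
          unfolding Suc using False sym_diff_is_pairs_iff[OF j, of K] by (simp only: if_False)
        ultimately show ?thesis by simp
      qed
      then have "(\<Sum>j\<in>{1..p}. (?x \<otimes>\<^bsub>?E\<^esub> blade {j, p + j}) K) = 0"
        by (intro sum.neutral ballI)
      then show ?thesis unfolding if_not_P[OF False] .
    next
      case True
      then obtain L where L: "L \<subseteq> {1..p}" "K = pairs p L" by blast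
      have fL: "finite L" using L(1) by (rule finite_subset) simp
      have summand: "(?x \<otimes>\<^bsub>?E\<^esub> blade {j, p + j}) K
          = (if j \<in> L \<and> card L = Suc m then fact m * pair_sign (Suc m) else 0)"
        if j: "j \<in> {1..p}" for j
      proof -
        let ?J = "{j, p + j}"
        define M where "M = sym_diff {j} L"
        have M: "M \<subseteq> {1..p}" "sym_diff ?J K = pairs p M" "finite M"
          using L(1) j fL by (auto simp: M_def L(2) sym_diff_pairs simp del: One_nat_def)
        have J: "?J \<subseteq> {1..2 * p}" "even (card ?J)" "finite ?J" using j by auto
        have fM: "finite (pairs p M)" using M(3) by (simp add: pairs_def)
        \<comment> \<open>The even intersection permits moving the pair to the left, where
          \<open>basis_coeff_pairs\<close> applies. With \<open>Q = 0\<close> a repeated pair gives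
          zero, so only \<open>j\<close> in \<open>L\<close> survives.\<close>
        have "pairs p M \<inter> ?J = (if j \<in> M then ?J else {})"
          using pair_in_pairs[OF j M(1)] by auto
        then have "(- 1) ^ card (pairs p M \<inter> ?J) = (1 :: real)" using J(2) by simp
        then have "basis_coeff (\<lambda>_. 0) (pairs p M) ?J = (- 1) ^ card M * (if j \<in> M then 0 else 1)"
          using basis_coeff_even_commute[OF fM J(3,2), of "\<lambda>_. 0"] basis_coeff_pairs[OF j M(1), of "\<lambda>_. 0"]
          by simp
        moreover have "?x (pairs p M) = (if card M = m then fact m * pair_sign m else 0)"
          unfolding Suc pairs_Int[OF M(1)] using M(1) by (subst if_P) blast+
        moreover have "(?x \<otimes>\<^bsub>?E\<^esub> blade ?J) K =
            basis_coeff (\<lambda>_. 0) (sym_diff ?J K) ?J * ?x (sym_diff ?J K)"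
          using x unfolding exterior_def by (rule blade_mult_right[OF J(1)])
        moreover have "j \<in> M \<longleftrightarrow> j \<notin> L" by (simp add: M_def)
        moreover have "card L = Suc (card M)" if "j \<in> L"
        proof -
          have "M = L - {j}" using that by (auto simp: M_def)
          then show ?thesis using card.remove[OF fL that] by simp
        qed
        ultimately show ?thesis unfolding M(2) by (auto simp: pair_sign_simps)
      qed
      have "(\<Sum>j\<in>{1..p}. (?x \<otimes>\<^bsub>?E\<^esub> blade {j, p + j}) K)
         = (\<Sum>j\<in>{1..p}. if j \<in> L then if card L = Suc m then fact m * pair_sign (Suc m) else 0 else 0)"
        by (intro sum.cong refl) (simp add: summand)
      \<comment> \<open>The summand is constant on the \<open>m + 1\<close> elements of
        \<open>L\<close>, which turns \<open>fact m\<close> into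
        \<open>fact (Suc m)\<close>.\<close>
      also have "\<dots> = (\<Sum>j\<in>L. if card L = Suc m then fact m * pair_sign (Suc m) else 0)"
        using L(1) by (simp add: sum.inter_restrict[symmetric] Int_absorb1)
      also have "\<dots> = (if card L = Suc m then fact (Suc m) * pair_sign (Suc m) else 0)"
        by simp
      finally show ?thesis using True L pairs_Int[OF L(1)] by simp
    qed
    finally show "(kahler_form p [^]\<^bsub>?E\<^esub> Suc m) K = (if \<exists>L\<subseteq>{1..p}. K = pairs p L
       then if card (K \<inter> {1..p}) = Suc m then fact (Suc m) * pair_sign (Suc m) else 0 else 0)" .
  qed
qed

text \<open>The factorials cancel, and at \<open>pairs p L\<close> only the power
  \<open>m = card L\<close> contributes. Forms and Clifford elements share one type of coefficient
  functions, so this is a literal equality.\<close>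

lemma rational_kahler_poly_eq: "rational_kahler_poly p (kahler_form p) = kahler_idem p"
proof
  fix K
  interpret ring "exterior (2 * p)" unfolding exterior_def by (rule ring_diag_clifford)
  let ?E = "exterior (2 * p)"
  note smult = diag_clifford_simps(6)[where n = "2 * p" and Q = "\<lambda>_. 0", folded exterior_def]
  have pow: "kahler_form p [^]\<^bsub>?E\<^esub> m \<in> carrier ?E" for m :: nat
    by (intro nat_pow_closed) (simp add: exterior_def kahler_form_closed)
  have "(\<Oplus>\<^bsub>?E\<^esub> m\<in>{0..p}. (1 / fact m) \<odot>\<^bsub>?E\<^esub> (kahler_form p [^]\<^bsub>?E\<^esub> m))
      = (\<lambda>K. \<Sum>m\<in>{0..p}. ((1 / fact m) \<odot>\<^bsub>?E\<^esub> (kahler_form p [^]\<^bsub>?E\<^esub> m)) K)"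
    unfolding exterior_def
  proof (rule finsum_diag_clifford)
    fix m
    show "(1 / fact m) \<odot>\<^bsub>diag_clifford (2 * p) (\<lambda>i. 0)\<^esub>
        (kahler_form p [^]\<^bsub>diag_clifford (2 * p) (\<lambda>i. 0)\<^esub> m) \<in> carrier (diag_clifford (2 * p) (\<lambda>i. 0))"
      using pow[of m] unfolding exterior_def by (auto simp: diag_clifford_simps(1,6))
  qed simp
  then have "rational_kahler_poly p (kahler_form p) K
      = 1 / 2 ^ p * (\<Sum>m\<in>{0..p}. 1 / fact m * (kahler_form p [^]\<^bsub>?E\<^esub> m) K)"
    by (simp only: rational_kahler_poly_def smult)
  also have "\<dots> = kahler_idem p K"
  proof (cases "\<exists>L\<subseteq>{1..p}. K = pairs p L")
    case True
    have "(\<Sum>m\<in>{0..p}. 1 / fact m * (kahler_form p [^]\<^bsub>?E\<^esub> m) K)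
       = (\<Sum>m\<in>{0..p}. if card (K \<inter> {1..p}) = m then pair_sign m else 0)"
      using True by (intro sum.cong refl) (simp add: kahler_form_power)
    \<comment> \<open>The exponent picked out is at most \<open>p\<close>, hence lies in the range
      of summation.\<close>
    also have "\<dots> = pair_sign (card (K \<inter> {1..p}))"
      using card_mono[of "{1..p}" "K \<inter> {1..p}"] by (simp add: sum.delta')
    finally show ?thesis using True by (simp add: kahler_idem_def)
  next
    case False
    then have "(kahler_form p [^]\<^bsub>?E\<^esub> m) K = 0" for m :: nat
      unfolding kahler_form_power by (rule if_not_P)
    moreover have "kahler_idem p K = 0" using False unfolding kahler_idem_def by (rule if_not_P)
    ultimately show ?thesis by simp
  qed
  finally show "rational_kahler_poly p (kahler_form p) K = kahler_idem p K" .
qed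

text \<open>Since \<open>pairs p L\<close> has \<open>2 * card L\<close> elements, degree 2 singles
  out the one-element sets \<open>L\<close>, whose sign is +1.\<close>

lemma grade_kahler_idem: "2 ^ p * grade 2 (kahler_idem p) K = kahler_form p K"
proof (cases "\<exists>j\<in>{1..p}. K = {j, p + j}")
  case True
  then obtain j where j: "j \<in> {1..p}" "K = pairs p {j}" by (auto simp: pairs_simps)
  then have "kahler_idem p K = 1 / 2 ^ p"
    using kahler_idem_pairs[of "{j}" p] by (simp add: pair_sign_simps)
  moreover have "card K = 2" using j card_pairs[of "{j}" p] by simp
  ultimately show ?thesis using True by (simp add: grade_def kahler_form_coeff)
next
  case False
  have "grade 2 (kahler_idem p) K = 0"
  proof (rule ccontr)
    assume "grade 2 (kahler_idem p) K \<noteq> 0"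
    then have K: "card K = 2" "kahler_idem p K \<noteq> 0" by (auto simp: grade_def split: if_splits)
    then obtain L where L: "L \<subseteq> {1..p}" "K = pairs p L" using kahler_idem_support by blast
    then have "card L = 1" using K(1) card_pairs[OF L(1)] by simp
    then obtain j where "L = {j}" by (auto simp: card_1_singleton_iff)
    then show False using False L by (auto simp: pairs_simps)
  qed
  then show ?thesis using False by (simp add: kahler_form_coeff)
qed

lemma smult_grade_kahler_idem: "2 ^ p \<odot>\<^bsub>clifford p q\<^esub> grade 2 (kahler_idem p) = kahler_form p"
  by (simp add: clifford_eq diag_clifford_simps(6) grade_kahler_idem fun_eq_iff)

lemma grade_smult_kahler_idem: "grade 2 (2 ^ p \<odot>\<^bsub>clifford p q\<^esub> kahler_idem p) = kahler_form p"
proof -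
  have "grade 2 (2 ^ p \<odot>\<^bsub>clifford p q\<^esub> kahler_idem p)
      = 2 ^ p \<odot>\<^bsub>clifford p q\<^esub> grade 2 (kahler_idem p)"
    by (auto simp: clifford_eq diag_clifford_simps(6) grade_def)
  then show ?thesis by (simp only: smult_grade_kahler_idem)
qed


section \<open>Symbols and the coordinate subalgebra\<close>

text \<open>Ordered products of generators are the same indicator functions in both algebras, so the
  symbol map is the identity on coefficients.\<close>

lemma symbol_eq:
  assumes "x \<in> carrier (clifford p q)"
  shows "symbol p q x = x"
proof -
  have "x \<in> carrier (diag_clifford (p + q) (\<lambda>i. 0))"
    using assms by (simp add: clifford_eq diag_clifford_simps(1))
  from diag_clifford_basis_expansion[OF this] show ?thesis
    unfolding symbol_def exterior_def by (rule sym)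
qed

lemma relabel_id:
  assumes "x \<in> carrier (diag_clifford n Q)"
  shows "relabel n {1..n} id x = x"
proof -
  have "x \<in> carrier (diag_clifford n (\<lambda>i. 0))"
    using assms by (simp add: diag_clifford_simps(1))
  from diag_clifford_basis_expansion[OF this] show ?thesis
    unfolding relabel_def exterior_def list.map_id by (rule sym)
qed

lemma carrier_mono: "m \<le> n \<Longrightarrow> carrier (diag_clifford m Q) \<subseteq> carrier (diag_clifford n Q')"
  by (fastforce simp: diag_clifford_simps(1))

lemma diag_clifford_mult_restrict:
  assumes "m \<le> n" "x \<in> carrier (diag_clifford m Q)" "y \<in> carrier (diag_clifford m Q)"
  shows "x \<otimes>\<^bsub>diag_clifford n Q\<^esub> y = x \<otimes>\<^bsub>diag_clifford m Q\<^esub> y"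
proof
  fix K
  have xy: "x \<in> carrier (diag_clifford n Q)" "y \<in> carrier (diag_clifford n Q)"
    using assms carrier_mono by blast+
  show "(x \<otimes>\<^bsub>diag_clifford n Q\<^esub> y) K = (x \<otimes>\<^bsub>diag_clifford m Q\<^esub> y) K"
    unfolding diag_clifford_mult_eq[OF xy] diag_clifford_mult_eq[OF assms(2,3)]
    using assms(1) carrier_outside[OF assms(2)]
    by (intro sum.mono_neutral_right) auto
qed

text \<open>Ordered products of the first \<open>m\<close> generators give all basis elements with
  indices up to \<open>m\<close>. Products of such elements are the same in both algebras, so
  nothing else is generated.\<close>

lemma generated_subalgebra_gens:
  assumes "m \<le> n"
  shows "generated_subalgebra (diag_clifford n Q) (gen ` {1..m}) = carrier (diag_clifford m Q)"
    (is "?A = _")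
proof
  show "?A \<subseteq> carrier (diag_clifford m Q)"
  proof
    fix x assume "x \<in> ?A"
    then show "x \<in> carrier (diag_clifford m Q)"
    proof induction
      case (mult x y)
      then show ?case
        by (simp only: diag_clifford_mult_restrict[OF assms] diag_clifford_mult_closed)
    next
      case (add x y)
      then show ?case unfolding diag_clifford_simps(1) mem_Collect_eq diag_clifford_simps(5)
        by (metis add.right_neutral)
    qed (auto simp: diag_clifford_simps(1,3,6) gen_def split: if_splits)
  qed
  have gen_prod: "gen_prod (diag_clifford n Q) is \<in> ?A" if "set is \<subseteq> {1..m}" for "is"
    using that
  proof (induction "is")
    case Nil
    show ?case unfolding gen_prod_def by (simp add: generated_subalgebra.one)
  next
    case (Cons i "is")
    then have "gen i \<in> ?A" "gen_prod (diag_clifford n Q) is \<in> ?A"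
      by (auto intro: generated_subalgebra.base)
    then have "gen i \<otimes>\<^bsub>diag_clifford n Q\<^esub> gen_prod (diag_clifford n Q) is \<in> ?A"
      by (rule generated_subalgebra.mult)
    then show ?case by (simp add: gen_prod_def)
  qed
  have blade: "blade I \<in> ?A" if "I \<subseteq> {1..m}" for I
  proof -
    have "finite I" "I \<subseteq> {1..n}" using that assms finite_subset by fastforce+
    then show ?thesis
      using gen_prod[of "sorted_list_of_set I"] gen_prod_sorted_list_of_set[of I n Q] that
      by (simp add: blade_def)
  qed
  show "carrier (diag_clifford m Q) \<subseteq> ?A"
  proof
    fix x assume x: "x \<in> carrier (diag_clifford m Q)"
    have "(\<lambda>K. \<Sum>I\<in>F. x I * blade I K) \<in> ?A" if "finite F" "F \<subseteq> Pow {1..m}" for F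
      using that
    proof (induction F rule: finite_induct)
      case empty
      \<comment> \<open>The inductive rules contain no zero element; it is obtained as
        \<open>0\<close> times the unit.\<close>
      have "0 \<odot>\<^bsub>diag_clifford n Q\<^esub> \<one>\<^bsub>diag_clifford n Q\<^esub> = (\<lambda>K. \<Sum>I\<in>{}. x I * blade I K)"
        by (simp add: fun_eq_iff diag_clifford_simps(6))
      then show ?case using generated_subalgebra.smult[OF generated_subalgebra.one] by metis
    next
      case (insert I F)
      have "x I \<odot>\<^bsub>diag_clifford n Q\<^esub> blade I \<in> ?A"
        using insert.prems by (intro generated_subalgebra.smult blade) auto
      then have "x I \<odot>\<^bsub>diag_clifford n Q\<^esub> blade I \<oplus>\<^bsub>diag_clifford n Q\<^esub> (\<lambda>K. \<Sum>I\<in>F. x I * blade I K) \<in> ?A"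
        using insert by (intro generated_subalgebra.add) auto
      also have "x I \<odot>\<^bsub>diag_clifford n Q\<^esub> blade I \<oplus>\<^bsub>diag_clifford n Q\<^esub> (\<lambda>K. \<Sum>I\<in>F. x I * blade I K)
          = (\<lambda>K. \<Sum>I\<in>insert I F. x I * blade I K)"
        using insert.hyps by (simp add: fun_eq_iff diag_clifford_simps(5,6))
      finally show ?case .
    qed
    from this[of "Pow {1..m}"] have "(\<lambda>K. \<Sum>I\<in>Pow {1..m}. x I * blade I K) \<in> ?A" by simp
    also have "(\<lambda>K. \<Sum>I\<in>Pow {1..m}. x I * blade I K) = x"
    proof
      fix K
      have "(\<Sum>I\<in>Pow {1..m}. x I * blade I K) = (\<Sum>I\<in>Pow {1..m}. if K = I then x I else 0)"
        by (intro sum.cong) (auto simp: blade_def)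
      also have "\<dots> = x K" using carrier_outside[OF x, of K] by (subst sum.delta') auto
      finally show "(\<Sum>I\<in>Pow {1..m}. x I * blade I K) = x K" .
    qed
    finally show "x \<in> ?A" .
  qed
qed

lemma real_algebra_iso_coordinate_subalgebra:
  assumes "m \<le> n"
  shows "real_algebra_iso (diag_clifford n Q\<lparr>carrier := carrier (diag_clifford m Q)\<rparr>) (diag_clifford m Q) id"
  unfolding real_algebra_iso_def
proof (intro conjI allI ballI)
  show "id \<in> ring_iso (diag_clifford n Q\<lparr>carrier := carrier (diag_clifford m Q)\<rparr>) (diag_clifford m Q)"
    by (rule ring_iso_memI)
       (simp_all add: diag_clifford_mult_restrict[OF assms] fun_eq_iff diag_clifford_simps(3,5))
qed (simp add: fun_eq_iff diag_clifford_simps(6))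

section \<open>Recovery of the unitary structure in the three algebras\<close>

text \<open>The first \<open>2 * p\<close> generators have \<open>p\<close> positive and
  \<open>p\<close> negative squares and already contain \<open>f\<close>. They generate a copy of
  the algebra with signature \<open>(p, p)\<close>, so the identity relabelling suffices.\<close>

lemma recovered_by_projection_kahler_form:
  assumes "p < q"
  shows "recovered_by_projection p q p p {1..2 * p} id {kahler_form p} (kahler_idem p)"
proof -
  have A: "generated_subalgebra (clifford p q) (gen ` {1..2 * p}) = carrier (clifford p p)"
    using assms unfolding clifford_eq mult_2 by (intro generated_subalgebra_gens) simp
  have iso: "real_algebra_iso (clifford p q\<lparr>carrier := carrier (clifford p p)\<rparr>) (clifford p p) id"
    using assms unfolding clifford_eq by (intro real_algebra_iso_coordinate_subalgebra) simp
  have w: "kahler_form p \<in> carrier (clifford p p)" "kahler_form p \<in> carrier (clifford p q)"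
    using kahler_form_closed[of p "clifford_sign p"] assms carrier_mono[of "2 * p" "p + q"]
    by (auto simp: clifford_eq mult_2)
  have "alg_eval (clifford p q) (kahler_idem p) (Scale (2 ^ p) (Component 2)) = kahler_form p"
    by (simp add: smult_grade_kahler_idem)
  moreover have "kahler_form p = relabel (p + p) {1..2 * p} id (symbol p q (kahler_form p))"
    using relabel_id[OF kahler_form_closed] by (simp add: symbol_eq[OF w(2)] mult_2)
  ultimately have "\<exists>\<psi>. alg_eval (clifford p q) (kahler_idem p) \<psi> \<in> carrier (clifford p p) \<and>
      kahler_form p = relabel (p + p) {1..2 * p} id (symbol p q (alg_eval (clifford p q) (kahler_idem p) \<psi>))"
    using w(1) by metis
  moreover have "kahler_idem p \<in> carrier (clifford p p)"
    by (auto simp: clifford_eq intro: kahler_idem_closed)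
  ultimately show ?thesis
    unfolding recovered_by_projection_def Let_def A using assms iso by (auto simp: mult_2)
qed

theorem corollary4p1:
  fixes p :: nat
  assumes "1 \<le> p"
  shows
    "(\<exists>f. recovered p p (defining_forms (U_structure p)) f \<and>
          symbol p p f = rational_kahler_poly p (kahler_form p) \<and>
          symbol p p (grade 2 (2 ^ p \<odot>\<^bsub>clifford p p\<^esub> f)) = kahler_form p) \<and>
     (\<forall>q\<in>{p + 1, p + 2}. \<exists>f S \<pi>.
          primitive_idempotent (clifford p q) f \<and>
          minimal_left_ideal (clifford p q) (left_multiples (clifford p q) f) \<and>
          recovered_by_projection p q p p S \<pi> (defining_forms (U_structure p)) f \<and>
          relabel (2 * p) S \<pi> (symbol p q f) = rational_kahler_poly p (kahler_form p) \<and>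
          relabel (2 * p) S \<pi> (symbol p q (grade 2 (2 ^ p \<odot>\<^bsub>clifford p q\<^esub> f))) = kahler_form p)"
proof -
  have forms: "defining_forms (U_structure p) = {kahler_form p}"
    by (simp add: defining_forms_def U_structure_def)
  have closed: "kahler_idem p \<in> carrier (clifford p q)" "kahler_form p \<in> carrier (clifford p q)"
    if "p \<le> q" for q
  proof -
    show "kahler_idem p \<in> carrier (clifford p q)"
      unfolding clifford_eq using that by (intro kahler_idem_closed) simp
    \<comment> \<open>The carrier depends only on the dimension, so \<open>undefined\<close> may
      stand for the quadratic form.\<close>
    show "kahler_form p \<in> carrier (clifford p q)"
      unfolding clifford_eq
      using kahler_form_closed[of p undefined] carrier_mono[of "2 * p" "p + q"] that by auto
  qed
  \<comment> \<open>The recovering expression is \<open>2 ^ p\<close> times the degree 2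
    component.\<close>
  have "alg_eval (clifford p p) (kahler_idem p) (Scale (2 ^ p) (Component 2)) = kahler_form p"
    by (simp add: smult_grade_kahler_idem)
  then have "kahler_form p
      = symbol p p (alg_eval (clifford p p) (kahler_idem p) (Scale (2 ^ p) (Component 2)))"
    by (simp only: symbol_eq closed order_refl)
  then have "recovered p p (defining_forms (U_structure p)) (kahler_idem p)"
    using minimal_left_ideal_kahler_idem[OF order_refl le_add1, of p] unfolding recovered_def forms by blast
  moreover have "symbol p p (kahler_idem p) = rational_kahler_poly p (kahler_form p)"
    by (simp only: symbol_eq closed order_refl rational_kahler_poly_eq)
  moreover have "symbol p p (grade 2 (2 ^ p \<odot>\<^bsub>clifford p p\<^esub> kahler_idem p)) = kahler_form p"
    by (simp only: grade_smult_kahler_idem symbol_eq closed order_refl)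
  moreover have "\<exists>f S \<pi>.
          primitive_idempotent (clifford p q) f \<and>
          minimal_left_ideal (clifford p q) (left_multiples (clifford p q) f) \<and>
          recovered_by_projection p q p p S \<pi> (defining_forms (U_structure p)) f \<and>
          relabel (2 * p) S \<pi> (symbol p q f) = rational_kahler_poly p (kahler_form p) \<and>
          relabel (2 * p) S \<pi> (symbol p q (grade 2 (2 ^ p \<odot>\<^bsub>clifford p q\<^esub> f))) = kahler_form p"
    if "q \<in> {p + 1, p + 2}" for q
  \<comment> \<open>The same idempotent serves as \<open>f\<close>, with \<open>{1..2 * p}\<close>
    for \<open>S\<close> and \<open>id\<close> for the relabelling.\<close>
  proof (intro exI conjI)
    have q: "p \<le> q" "p < q" "q \<le> p + 2" using that by auto
    show "primitive_idempotent (clifford p q) (kahler_idem p)"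
      "minimal_left_ideal (clifford p q) (left_multiples (clifford p q) (kahler_idem p))"
      using minimal_left_ideal_kahler_idem[OF q(1,3)] by blast+
    show "recovered_by_projection p q p p {1..2 * p} id (defining_forms (U_structure p)) (kahler_idem p)"
      unfolding forms by (rule recovered_by_projection_kahler_form[OF q(2)])
    have "relabel (2 * p) {1..2 * p} id (kahler_idem p) = kahler_idem p"
      by (rule relabel_id, rule kahler_idem_closed[of p "2 * p"]) simp
    then show "relabel (2 * p) {1..2 * p} id (symbol p q (kahler_idem p))
        = rational_kahler_poly p (kahler_form p)"
      by (simp only: symbol_eq closed q(1) rational_kahler_poly_eq)
    show "relabel (2 * p) {1..2 * p} id (symbol p q (grade 2 (2 ^ p \<odot>\<^bsub>clifford p q\<^esub> kahler_idem p)))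
        = kahler_form p"
      by (simp only: grade_smult_kahler_idem symbol_eq closed q(1) relabel_id[OF kahler_form_closed])
  qed
  ultimately show ?thesis by blast
qed

end
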